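(* Fix $d\ge2$. The infimum of the metric entropy $h_{\mu_{geo}}(f)$ over all $\tau\in\mathcal{T}\mathcal{U}\mathcal{S}$ and all $f\in\tau$ with their symmetric $f$-invariant probability measures $\mu_{geo}$ is zero.
   Context: $T$ is the unit circle. A circle endomorphism is an orientation-preserving covering map $f:T\to T$ of degree $d\ge2$ with $f(1)=1$; its lift is the homeomorphism $F:\mathbb{R}\to\mathbb{R}$ with $F(0)=0$, $F(x+1)=F(x)+d$ and $e^{2\pi i F(x)}=f(e^{2\pi i x})$. $f$ is uniformly symmetric if there is a bounded function $\varepsilon(t)>0$, $t>0$, with $\varepsilon(t)\to0$ as $t\to0^{+}$ and $$\frac{1}{1+\varepsilon(t)}\le\frac{|F^{-n}(x+t)-F^{-n}(x)|}{|F^{-n}(x)-F^{-n}(x-t)|}\le 1+\varepsilon(t)\quad\text{for all }x\in\mathbb{R},\ t>0,\ n>0.$$ $\mathcal{U}\mathcal{S}$ is the set of uniformly symmetric circle endomorphisms of degree $d$. For $f\in\mathcal{U}\mathcal{S}$, $h_f$ is the unique orientation-preserving homeomorphism of $T$ with $h_f(1)=1$ and $f\circ h_f=h_f\circ q_d$, $q_d(z)=z^d$. $\mathcal{T}\mathcal{U}\mathcal{S}$ is the set of classes $\tau=[(f,h_f)]$, where $(f,h_f)\sim(g,h_g)$ iff $h_f\circ h_g^{-1}$ is symmetric; $f\in\tau$ means $\tau=[(f,h_f)]$. Thus the infimum is over all $f\in\mathcal{U}\mathcal{S}$ and all symmetric $f$-invariant probability measures. A circle homeomorphism $h$ (orientation-preserving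 homeomorphism of $T$) with lift $H$ ($H(x+1)=H(x)+1$) is symmetric if there is a bounded function $\varepsilon(t)>0$ with $\varepsilon(t)\to0$ as $t\to0^+$ and $\frac1{1+\varepsilon(t)}\le\frac{|H(x+t)-H(x)|}{|H(x)-H(x-t)|}\le1+\varepsilon(t)$ for all $x\in\mathbb{R}$, $t>0$. A probability measure $\mu$ on $T$ is symmetric if its distribution function $h(z)=\mu([1,z])$ ($[1,z]$ the positively oriented arc from $1$ to $z$, values in $[0,1]$ viewed on $\mathbb{R}/\mathbb{Z}\cong T$) is a symmetric circle homeomorphism. $h_\mu(f)$ is the measure-theoretic (metric) entropy. *)

theory Defs
  imports "HOL-Probability.Probability"
begin

abbreviation circle :: "complex set"
  where "circle \<equiv> sphere 0 1"

text \<open>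
  Maps of the circle are functions on the complex numbers whose values off the circle are fixed by
  membership in \<^term>\<open>extensional circle\<close>, so that equality of such functions is equality of
  circle maps.  Since \<^term>\<open>F\<close> is required to be increasing, having a lift of degree \<open>d\<close> expresses
  both that the degree is \<open>d\<close> and that the orientation is preserved.
\<close>

definition is_lift :: "nat \<Rightarrow> (complex \<Rightarrow> complex) \<Rightarrow> (real \<Rightarrow> real) \<Rightarrow> bool"
  where "is_lift d f F \<longleftrightarrow>
    homeomorphism UNIV UNIV F (inv F) \<and> strict_mono F \<and>
    (\<forall>x. F (x + 1) = F x + real d) \<and>
    (\<forall>x. cis (2 * pi * F x) = f (cis (2 * pi * x)))"

definition circle_endomorphism :: "nat \<Rightarrow> (complex \<Rightarrow> complex) \<Rightarrow> bool"
  where "circle_endomorphism d f \<longleftrightarrow>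
    f \<in> extensional circle \<and> covering_space circle f circle \<and> f 1 = 1 \<and>
    (\<exists>F. is_lift d f F \<and> F 0 = 0)"

definition circle_homeo :: "(complex \<Rightarrow> complex) \<Rightarrow> bool"
  where "circle_homeo h \<longleftrightarrow>
    h \<in> extensional circle \<and> (\<exists>k. homeomorphism circle circle h k) \<and> (\<exists>H. is_lift 1 h H)"

definition symmetry_modulus :: "(real \<Rightarrow> real) \<Rightarrow> bool"
  where "symmetry_modulus \<epsilon> \<longleftrightarrow>
    (\<forall>t>0. \<epsilon> t > 0) \<and> bounded (\<epsilon> ` {0<..}) \<and> (\<epsilon> \<longlongrightarrow> 0) (at_right 0)"

definition symmetric_with :: "(real \<Rightarrow> real) \<Rightarrow> (real \<Rightarrow> real) \<Rightarrow> bool"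
  where "symmetric_with \<epsilon> G \<longleftrightarrow>
    (\<forall>x. \<forall>t>0.
      1 / (1 + \<epsilon> t) \<le> \<bar>G (x + t) - G x\<bar> / \<bar>G x - G (x - t)\<bar> \<and>
      \<bar>G (x + t) - G x\<bar> / \<bar>G x - G (x - t)\<bar> \<le> 1 + \<epsilon> t)"

definition uniformly_symmetric :: "nat \<Rightarrow> (complex \<Rightarrow> complex) \<Rightarrow> bool"
  where "uniformly_symmetric d f \<longleftrightarrow>
    (\<exists>F \<epsilon>. is_lift d f F \<and> F 0 = 0 \<and> symmetry_modulus \<epsilon> \<and>
       (\<forall>n>0. symmetric_with \<epsilon> ((inv F) ^^ n)))"

definition US :: "nat \<Rightarrow> (complex \<Rightarrow> complex) set"
  where "US d = {f. circle_endomorphism d f \<and> uniformly_symmetric d f}"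

definition symmetric_homeo :: "(complex \<Rightarrow> complex) \<Rightarrow> bool"
  where "symmetric_homeo h \<longleftrightarrow>
    circle_homeo h \<and> (\<exists>H \<epsilon>. is_lift 1 h H \<and> symmetry_modulus \<epsilon> \<and> symmetric_with \<epsilon> H)"

definition conj_homeo :: "nat \<Rightarrow> (complex \<Rightarrow> complex) \<Rightarrow> complex \<Rightarrow> complex"
  where "conj_homeo d f =
    (THE h. circle_homeo h \<and> h 1 = 1 \<and> (\<forall>z\<in>circle. f (h z) = h (z ^ d)))"

definition marked_US :: "nat \<Rightarrow> ((complex \<Rightarrow> complex) \<times> (complex \<Rightarrow> complex)) set"
  where "marked_US d = (\<lambda>f. (f, conj_homeo d f)) ` US d"

definition teich_rel ::
    "nat \<Rightarrow> (((complex \<Rightarrow> complex) \<times> (complex \<Rightarrow> complex)) \<times>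
             ((complex \<Rightarrow> complex) \<times> (complex \<Rightarrow> complex))) set"
  where "teich_rel d = {((f, h), (g, k)).
    (f, h) \<in> marked_US d \<and> (g, k) \<in> marked_US d \<and>
    symmetric_homeo (compose circle h (inv_into circle k))}"

definition TUS :: "nat \<Rightarrow> ((complex \<Rightarrow> complex) \<times> (complex \<Rightarrow> complex)) set set"
  where "TUS d = marked_US d // teich_rel d"

definition represents ::
    "nat \<Rightarrow> (complex \<Rightarrow> complex) \<Rightarrow> ((complex \<Rightarrow> complex) \<times> (complex \<Rightarrow> complex)) set \<Rightarrow> bool"
  where "represents d f \<tau> \<longleftrightarrow> f \<in> US d \<and> \<tau> = teich_rel d `` {(f, conj_homeo d f)}"

definition circle_prob :: "complex measure \<Rightarrow> bool"
  where "circle_prob \<mu> \<longleftrightarrow> prob_space \<mu> \<and> sets \<mu> = sets (restrict_space borel circle)"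

text \<open>The positively oriented closed arc from \<open>1\<close> to \<open>z\<close>; \<^term>\<open>Arg2pi\<close> takes values in \<open>[0, 2\<pi>)\<close>.\<close>

definition arc_from_one :: "complex \<Rightarrow> complex set"
  where "arc_from_one z = {w \<in> circle. Arg2pi w \<le> Arg2pi z}"

definition dist_fun :: "complex measure \<Rightarrow> complex \<Rightarrow> complex"
  where "dist_fun \<mu> = (\<lambda>z\<in>circle. cis (2 * pi * measure \<mu> (arc_from_one z)))"

definition symmetric_measure :: "complex measure \<Rightarrow> bool"
  where "symmetric_measure \<mu> \<longleftrightarrow> circle_prob \<mu> \<and> symmetric_homeo (dist_fun \<mu>)"

definition invariant_measure :: "'a measure \<Rightarrow> ('a \<Rightarrow> 'a) \<Rightarrow> bool"
  where "invariant_measure \<mu> f \<longleftrightarrow> f \<in> measurable \<mu> \<mu> \<and> distr \<mu> \<mu> f = \<mu>"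

definition finite_partition :: "'a measure \<Rightarrow> 'a set set \<Rightarrow> bool"
  where "finite_partition \<mu> P \<longleftrightarrow> finite P \<and> P \<subseteq> sets \<mu> \<and> partition_on (space \<mu>) P"

text \<open>
  Null cells contribute \<open>0\<close> because \<^prop>\<open>0 * ln 0 = (0 :: real)\<close>.
\<close>

definition partition_entropy :: "'a measure \<Rightarrow> 'a set set \<Rightarrow> real"
  where "partition_entropy \<mu> P = - (\<Sum>A\<in>P. measure \<mu> A * ln (measure \<mu> A))"

text \<open>
  The join of the partitions \<open>f\<^sup>-\<^sup>i P\<close> for \<open>i < n\<close>: a cell is the set of points with a given
  itinerary of length \<open>n\<close>.  Distinct itineraries give the same set only when that set is empty.
\<close>

definition iterated_join :: "'a measure \<Rightarrow> ('a \<Rightarrow> 'a) \<Rightarrow> 'a set set \<Rightarrow> nat \<Rightarrow> 'a set set"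
  where "iterated_join \<mu> f P n =
    (\<lambda>A. {x \<in> space \<mu>. \<forall>i<n. (f ^^ i) x \<in> A i}) ` ({..<n} \<rightarrow>\<^sub>E P)"

text \<open>The limit exists for invariant probability measures, by subadditivity.\<close>

definition entropy_wrt :: "'a measure \<Rightarrow> ('a \<Rightarrow> 'a) \<Rightarrow> 'a set set \<Rightarrow> real"
  where "entropy_wrt \<mu> f P =
    lim (\<lambda>n. partition_entropy \<mu> (iterated_join \<mu> f P n) / real n)"

definition metric_entropy :: "'a measure \<Rightarrow> ('a \<Rightarrow> 'a) \<Rightarrow> ereal"
  where "metric_entropy \<mu> f = (SUP P \<in> {P. finite_partition \<mu> P}. ereal (entropy_wrt \<mu> f P))"

end

theory Submission
  imports Defs
begin

text \<open>
  The measure is always Lebesgue measure, whose distribution function is the identity; only the map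
  varies. Its lift is the inverse of a function \<open>G\<close> with \<open>G' = p\<close>. Invariance of Lebesgue measure
  amounts to \<open>p x + p (x + 1) + \<dots> + p (x + d - 1) = 1\<close>, and log-Lipschitz continuity of \<open>p\<close> gives
  bounded distortion of all iterates of \<open>G\<close>, hence uniform symmetry. A softmax weight \<open>p\<close> may be
  concentrated on \<open>[0, 1]\<close>, so that one of the \<open>d\<close> branches occupies nearly the whole circle. The
  branch intervals form a generating partition, whose static entropy bounds the metric entropy and
  is then arbitrarily small.

  The generator bound needs no conditional entropy: if the cell of a partition \<open>P\<close> is predicted from
  \<open>m\<close> symbols of the generator up to an error process \<open>E\<close>, then the \<open>P\<close>-itinerary of length \<open>n\<close> is
  a function of \<open>m + n\<close> generator symbols and \<open>n\<close> symbols of \<open>E\<close>, and the entropy of \<open>E\<close> is small.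
\<close>

section \<open>Entropy of finite-valued processes\<close>

text \<open>The inverse branches of the circle map are \<open>x \<mapsto> G (x + i)\<close> for
  \<open>i < d\<close>, with derivatives \<open>p (x + i)\<close>. Being positive with sum 1, these
  are transition probabilities from a point to its \<open>d\<close> preimages, and the sum condition
  says that the transfer operator for Lebesgue measure fixes the constant 1. Working with
  \<open>G\<close> instead of the lift \<open>F\<close> suits the definition of uniform symmetry,
  which speaks only of iterates of the inverse; these are contractions, so distortions can be
  summed. The tension is that a dominant branch has derivative close to 1 on most of its interval,
  so the contraction and with it the distortion constant deteriorate as the entropy decreases. This
  is harmless: the modulus has to be uniform in the iterate but may depend on the map. A softmax
  \<open>exp (N * c)\<close> of a smooth function of period \<open>d\<close> provides the weights
  for every \<open>N > 0\<close>: positivity and normalisation are built in, the logarithm is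
  Lipschitz because the exponent is, and growing \<open>N\<close> concentrates the mass on the
  branch where \<open>c\<close> is largest.\<close>

text \<open>Fekete's subadditive lemma; the limit is the infimum \<open>L\<close> of the quotients.
  It is needed because \<open>entropy_wrt\<close> is a \<open>lim\<close>, which carries no
  information for a divergent sequence. Nonnegativity bounds the quotients below and lets the sum
  \<open>M\<close> dominate every remainder \<open>a (n mod k)\<close>.\<close>

lemma fekete_nonneg:
  fixes a :: "nat \<Rightarrow> real"
  assumes sub: "\<And>m n. a (m + n) \<le> a m + a n" and nonneg: "\<And>n. 0 \<le> a n"
  shows "convergent (\<lambda>n. a n / real n)"
proof -
  define L where "L = (INF n\<in>{1..}. a n / real n)"
  have bdd: "bdd_below ((\<lambda>n. a n / real n) ` {1..})"
    by (rule bdd_belowI[of _ 0]) (auto simp: nonneg)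
  have "(\<lambda>n. a n / real n) \<longlonglongrightarrow> L"
  proof (rule LIMSEQ_I)
    fix e :: real assume e: "e > 0"
    have "\<exists>x\<in>(\<lambda>n. a n / real n) ` {1..}. x < L + e / 2"
      unfolding L_def by (rule cInf_lessD) (use e in auto)
    then obtain k where k: "k \<ge> 1" "a k / real k < L + e / 2" by auto
    define M where "M = (\<Sum>r<k. a r)"
    have mult: "a (q * k + r) \<le> real q * a k + a r" for q r
    proof (induction q)
      case (Suc q)
      have "a (Suc q * k + r) \<le> a k + a (q * k + r)"
        using sub[of k "q * k + r"] by (simp add: add.assoc)
      with Suc show ?case by (simp add: algebra_simps)
    qed simp
    have bound: "a n / real n \<le> a k / real k + M / real n" if n: "n \<ge> 1" for n
    proof -
      have "n mod k < k" using k by simp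
      then have "a (n mod k) \<le> M"
        unfolding M_def by (intro member_le_sum) (auto simp: nonneg)
      then have "a n \<le> real (n div k) * a k + M"
        using mult[of "n div k" "n mod k"] by simp
      moreover have "real (n div k) \<le> real n / real k"
        using k(1) div_times_less_eq_dividend[of n k]
        by (simp add: le_divide_eq flip: of_nat_mult)
      ultimately have "a n \<le> real n / real k * a k + M"
        using mult_right_mono[OF _ nonneg[of k]] by (smt (verit))
      then have "a n / real n \<le> (real n / real k * a k + M) / real n"
        by (intro divide_right_mono) auto
      also have "\<dots> = a k / real k + M / real n" using n by (simp add: field_simps)
      finally show ?thesis .
    qed
    obtain N :: nat where N: "N > 2 * M / e" using reals_Archimedean2 by blast
    show "\<exists>no. \<forall>n\<ge>no. norm (a n / real n - L) < e"
    proof (intro exI[of _ "Suc N"] allI impI)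
      fix n assume n: "n \<ge> Suc N"
      have "L \<le> a n / real n"
        unfolding L_def by (rule cINF_lower[OF bdd]) (use n in auto)
      moreover have "real n > 2 * M / e" using N n by linarith
      then have "M / real n < e / 2" using e n by (simp add: field_simps)
      moreover have "a n / real n \<le> a k / real k + M / real n" using bound n by simp
      ultimately have "L \<le> a n / real n" "a n / real n < L + e" using k(2) by linarith+
      then show "norm (a n / real n - L) < e" by simp
    qed
  qed
  then show ?thesis by (auto simp: convergent_def)
qed

text \<open>The function \<open>- (t * ln t)\<close> is not monotone on the unit interval, but this
  majorant is, so a bound on a probability becomes a bound on its entropy term. The source is
  \<open>ln s \<le> s - 1\<close> at \<open>s = 1 / sqrt t\<close>.\<close>

lemma neg_mult_ln_le_sqrt:
  fixes t :: real
  assumes "t \<ge> 0"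
  shows "- (t * ln t) \<le> 2 * sqrt t"
proof (cases "t = 0")
  case False
  with assms have t: "t > 0" by simp
  have "- ln (sqrt t) = ln (1 / sqrt t)" using t by (simp add: ln_div)
  also have "\<dots> \<le> 1 / sqrt t - 1" using t by (intro ln_le_minus_one) simp
  finally have "- ln (sqrt t) \<le> 1 / sqrt t" by simp
  then have "- ln t \<le> 2 / sqrt t" using t by (simp add: ln_sqrt)
  then have "t * - ln t \<le> t * (2 / sqrt t)" using t by (intro mult_left_mono) auto
  also have "\<dots> = 2 * (t / sqrt t)" by simp
  also have "t / sqrt t = sqrt t" using t by (simp add: real_div_sqrt)
  finally show ?thesis by simp
qed simp

text \<open>Meant for \<open>t\<close> near 1, where the square root bound is useless. Here
  \<open>ln s \<le> s - 1\<close> is taken at \<open>s = 1 / t\<close>.\<close>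

lemma neg_mult_ln_le_compl:
  fixes t :: real
  assumes "t \<ge> 0"
  shows "- (t * ln t) \<le> 1 - t"
proof (cases "t = 0")
  case False
  with assms have t: "t > 0" by simp
  have "- ln t = ln (1 / t)" using t by (simp add: ln_div)
  also have "\<dots> \<le> 1 / t - 1" using t by (intro ln_le_minus_one) simp
  finally have "t * - ln t \<le> t * (1 / t - 1)" using t by (intro mult_left_mono) auto
  also have "\<dots> = 1 - t" using t by (simp add: algebra_simps)
  finally show ?thesis by simp
qed simp

section \<open>Shannon entropy in a measure-preserving system\<close>

locale measure_preserving = prob_space M for M :: "'a measure" +
  fixes f :: "'a \<Rightarrow> 'a"
  assumes measurable_map [measurable]: "f \<in> measurable M M"
    and distr_map: "distr M M f = M"
begin

text \<open>Base \<open>exp 1\<close> makes the library entropy use the natural logarithm, in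
  agreement with \<open>partition_entropy\<close>.\<close>

sublocale information_space M "exp 1"
  by unfold_locales simp

notation entropy_Pow ("\<H>'(_')")

text \<open>Values in \<open>S\<close> that are not attained have probability 0 and contribute
  \<open>0 * ln 0 = 0\<close>. The freedom in \<open>S\<close> allows entropies of different
  functions to be compared over one index set.\<close>

lemma entropy_eq_sum:
  assumes X: "simple_function M X" and S: "finite S" "X ` space M \<subseteq> S"
  shows "\<H>(X) = - (\<Sum>v\<in>S. prob {x \<in> space M. X x = v} * ln (prob {x \<in> space M. X x = v}))"
proof -
  have vi: "X -` {v} \<inter> space M = {x \<in> space M. X x = v}" for v by auto
  have "\<H>(X) = - (\<Sum>v\<in>X ` space M. prob {x \<in> space M. X x = v} * ln (prob {x \<in> space M. X x = v}))"
    using entropy_simple_distributed[OF simple_distributedI[OF X measure_nonneg refl]]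
    by (simp add: vi log_def)
  also have "(\<Sum>v\<in>X ` space M. prob {x \<in> space M. X x = v} * ln (prob {x \<in> space M. X x = v})) =
      (\<Sum>v\<in>S. prob {x \<in> space M. X x = v} * ln (prob {x \<in> space M. X x = v}))"
  proof (rule sum.mono_neutral_left[OF S], safe)
    fix v assume "v \<notin> X ` space M"
    then have "{x \<in> space M. X x = v} = {}" by auto
    then show "prob {x \<in> space M. X x = v} * ln (prob {x \<in> space M. X x = v}) = 0"
      by (metis measure_empty mult_zero_left)
  qed
  finally show ?thesis .
qed

lemma entropy_nonneg_simple:
  assumes X: "simple_function M X"
  shows "0 \<le> \<H>(X)"
proof -
  have "(\<Sum>v\<in>X ` space M. prob {x \<in> space M. X x = v} * ln (prob {x \<in> space M. X x = v})) \<le> 0"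
  proof (rule sum_nonpos)
    fix v
    have "ln t \<le> 0" if "0 \<le> t" "t \<le> 1" for t :: real
      using that by (cases "t = 0") auto
    then show "prob {x \<in> space M. X x = v} * ln (prob {x \<in> space M. X x = v}) \<le> 0"
      by (intro mult_nonneg_nonpos) auto
  qed
  then show ?thesis using entropy_eq_sum[OF X simple_functionD(1)[OF X] subset_refl] by simp
qed

lemma entropy_pair_le:
  assumes "simple_function M X" "simple_function M Y"
  shows "\<H>(\<lambda>x. (X x, Y x)) \<le> \<H>(X) + \<H>(Y)"
  using entropy_chain_rule[OF assms] conditional_entropy_less_eq_entropy[OF assms(2,1)] by simp

lemma entropy_compose_map:
  assumes X: "simple_function M X"
  shows "simple_function M (\<lambda>x. X (f x))" and "\<H>(\<lambda>x. X (f x)) = \<H>(X)"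
proof -
  have sp: "f x \<in> space M" if "x \<in> space M" for x
    using measurable_space[OF measurable_map that] .
  have meas: "{x \<in> space M. X x = v} \<in> sets M" for v
    using simple_functionD(2)[OF X, of "{v}"] by (simp add: vimage_def Collect_conj_eq Int_commute)
  have pre: "f -` {x \<in> space M. X x = v} \<inter> space M = {x \<in> space M. X (f x) = v}" for v
    using sp by auto
  have meas': "{x \<in> space M. X (f x) = v} \<in> sets M" for v
    using measurable_sets[OF measurable_map meas[of v]] unfolding pre .
  have sub: "(\<lambda>x. X (f x)) ` space M \<subseteq> X ` space M" using sp by auto
  show sf: "simple_function M (\<lambda>x. X (f x))"
    unfolding simple_function_def
  proof safe
    show "finite ((\<lambda>x. X (f x)) ` space M)"
      using finite_subset[OF sub simple_functionD(1)[OF X]] .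
    fix x
    have "(\<lambda>x. X (f x)) -` {X (f x)} \<inter> space M = {y \<in> space M. X (f y) = X (f x)}" by auto
    then show "(\<lambda>x. X (f x)) -` {X (f x)} \<inter> space M \<in> sets M" using meas' by simp
  qed
  have "prob {x \<in> space M. X (f x) = v} = prob {x \<in> space M. X x = v}" for v
    using measure_distr[OF measurable_map meas[of v]] unfolding distr_map pre by simp
  then show "\<H>(\<lambda>x. X (f x)) = \<H>(X)"
    using entropy_eq_sum[OF sf simple_functionD(1)[OF X] sub]
      entropy_eq_sum[OF X simple_functionD(1)[OF X] subset_refl] by simp
qed

text \<open>The entropy term of each value is at most \<open>2 * sqrt \<delta>\<close>: for
  \<open>v\<close> by the bound through \<open>1 - t\<close>, for every other value because its
  probability is at most \<delta>. This estimate serves both the error process and the generator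
  itself.\<close>

lemma entropy_le_of_dominant_value:
  assumes X: "simple_function M X" and S: "finite S" "X ` space M \<subseteq> S" "card S \<le> N"
    and v: "v \<in> S" "prob {x \<in> space M. X x \<noteq> v} \<le> \<delta>"
  shows "\<H>(X) \<le> 2 * real N * sqrt \<delta>"
proof -
  let ?p = "\<lambda>w. prob {x \<in> space M. X x = w}"
  have meas: "{x \<in> space M. X x = w} \<in> sets M" for w
    using simple_functionD(2)[OF X, of "{w}"] by (simp add: vimage_def Collect_conj_eq Int_commute)
  have neq: "{x \<in> space M. X x \<noteq> w} = space M - {x \<in> space M. X x = w}" for w by auto
  have compl: "prob {x \<in> space M. X x \<noteq> w} = 1 - ?p w" for w
    unfolding neq by (rule prob_compl[OF meas])
  have d0: "0 \<le> \<delta>" using v(2) measure_nonneg order_trans by blast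
  have each: "- (?p w * ln (?p w)) \<le> 2 * sqrt \<delta>" for w
  proof (cases "w = v")
    case True
    have "- (?p v * ln (?p v)) \<le> 1 - ?p v" by (rule neg_mult_ln_le_compl) simp
    also have "\<dots> \<le> 2 * sqrt (1 - ?p v)"
    proof -
      have "(1 - ?p v)\<^sup>2 \<le> 1 - ?p v"
        using power_decreasing[of 1 2 "1 - ?p v"] by (simp add: prob_le_1)
      then have "1 - ?p v \<le> sqrt (1 - ?p v)" by (rule real_le_rsqrt)
      moreover have "0 \<le> sqrt (1 - ?p v)" by (simp add: prob_le_1)
      ultimately show ?thesis by linarith
    qed
    also have "\<dots> \<le> 2 * sqrt \<delta>" using v(2) compl by simp
    finally show ?thesis using True by simp
  next
    case False
    have "?p w \<le> prob {x \<in> space M. X x \<noteq> v}"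
      using False meas by (intro finite_measure_mono) (auto simp: neq)
    with v(2) have "?p w \<le> \<delta>" by simp
    then have "2 * sqrt (?p w) \<le> 2 * sqrt \<delta>" by simp
    with neg_mult_ln_le_sqrt[of "?p w"] show ?thesis by (meson measure_nonneg order_trans)
  qed
  have "\<H>(X) = (\<Sum>w\<in>S. - (?p w * ln (?p w)))"
    using entropy_eq_sum[OF X S(1,2)] by (simp add: sum_negf)
  also have "\<dots> \<le> (\<Sum>w\<in>S. 2 * sqrt \<delta>)" by (intro sum_mono each)
  also have "\<dots> = real (card S) * (2 * sqrt \<delta>)" by simp
  also have "\<dots> \<le> real N * (2 * sqrt \<delta>)" using S(3) d0 by (intro mult_right_mono) auto
  finally show ?thesis by simp
qed

section \<open>Itineraries\<close>

definition itin :: "('a \<Rightarrow> 'b) \<Rightarrow> nat \<Rightarrow> 'a \<Rightarrow> 'b list" where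
  "itin c n x = map (\<lambda>i. c ((f ^^ i) x)) [0..<n]"

lemma length_itin [simp]: "length (itin c n x) = n"
  by (simp add: itin_def)

lemma itin_add: "itin c (m + n) x = itin c m x @ itin c n ((f ^^ m) x)"
proof (rule nth_equalityI)
  fix i assume i: "i < length (itin c (m + n) x)"
  have "(f ^^ i) x = (f ^^ (i - m)) ((f ^^ m) x)" if "\<not> i < m"
    using that funpow_add[of "i - m" m f] by simp
  with i show "itin c (m + n) x ! i = (itin c m x @ itin c n ((f ^^ m) x)) ! i"
    by (simp add: itin_def nth_append)
qed simp

lemma simple_function_entropy_funpow:
  assumes X: "simple_function M X"
  shows "simple_function M (\<lambda>x. X ((f ^^ n) x)) \<and> \<H>(\<lambda>x. X ((f ^^ n) x)) = \<H>(X)"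
proof (induction n)
  case (Suc n)
  then show ?case
    using entropy_compose_map[of "\<lambda>x. X ((f ^^ n) x)"] by (simp add: funpow_swap1)
qed (use X in simp)

lemma simple_function_itin:
  assumes c: "simple_function M c"
  shows "simple_function M (itin c n)"
proof (induction n)
  case 0
  then show ?case by (simp add: itin_def[abs_def])
next
  case (Suc n)
  have "simple_function M (\<lambda>x. itin c n x @ [c ((f ^^ n) x)])"
    using simple_function_compose2[OF Suc, of "\<lambda>x. c ((f ^^ n) x)" "\<lambda>l z. l @ [z]"]
      simple_function_entropy_funpow[OF c] by blast
  then show ?case by (simp add: itin_def[abs_def])
qed

lemma entropy_itin_add_le:
  assumes c: "simple_function M c"
  shows "\<H>(itin c (m + n)) \<le> \<H>(itin c m) + \<H>(itin c n)"
proof -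
  note si = simple_function_itin[OF c]
  have s: "simple_function M (\<lambda>x. itin c n ((f ^^ m) x))"
    and e: "\<H>(\<lambda>x. itin c n ((f ^^ m) x)) = \<H>(itin c n)"
    using simple_function_entropy_funpow[OF si] by blast+
  have eq: "itin c (m + n) = (\<lambda>(k, l). k @ l) \<circ> (\<lambda>x. (itin c m x, itin c n ((f ^^ m) x)))"
    by (auto simp: itin_add)
  have "\<H>(itin c (m + n)) \<le> \<H>(\<lambda>x. (itin c m x, itin c n ((f ^^ m) x)))"
    unfolding eq by (rule entropy_data_processing[OF simple_function_Pair[OF si s]])
  also have "\<dots> \<le> \<H>(itin c m) + \<H>(itin c n)"
    using entropy_pair_le[OF si s] unfolding e .
  finally show ?thesis .
qed

lemma entropy_itin_le:
  assumes c: "simple_function M c"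
  shows "\<H>(itin c n) \<le> real n * \<H>(c)"
proof (induction n)
  case 0
  \<comment> \<open>The itinerary of length 0 is constantly \<open>[]\<close>, so the dominant value
    estimate applies with error probability 0.\<close>
  have "\<H>(itin c 0) \<le> 2 * real 1 * sqrt 0"
    by (rule entropy_le_of_dominant_value[OF simple_function_itin[OF c], where S = "{[]}" and N = 1 and v = "[]"])
      (auto simp: itin_def)
  then show ?case by simp
next
  case (Suc n)
  have eq: "itin c 1 = (\<lambda>v. [v]) \<circ> c" by (auto simp: itin_def)
  have "\<H>(itin c 1) \<le> \<H>(c)" unfolding eq by (rule entropy_data_processing[OF c])
  with Suc entropy_itin_add_le[OF c, of n 1] show ?case by (simp add: algebra_simps)
qed

text \<open>The error process records \<open>c\<close> exactly where its prediction \<open>g\<close> from the next \<open>m\<close> symbols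
  of the \<open>q\<close>-itinerary fails, so the \<open>q\<close>-itinerary and the error process determine the
  \<open>c\<close>-itinerary.\<close>

lemma entropy_itin_le_prediction:
  assumes c: "simple_function M c" and q: "simple_function M q"
    and E: "E = (\<lambda>x. if c x = g (itin q m x) then None else Some (c x))"
  shows "simple_function M E" and "\<H>(itin c n) \<le> real (m + n) * \<H>(q) + real n * \<H>(E)"
proof -
  note sq = simple_function_itin[OF q]
  show sE: "simple_function M E"
    unfolding E
    using simple_function_compose2[OF c sq[of m], of "\<lambda>v l. if v = g l then None else Some v"]
    by simp
  \<comment> \<open>The decoder: at time \<open>i\<close> it uses the recorded error symbol if there
    is one, and otherwise predicts from the window of \<open>m\<close> symbols starting at
    \<open>i\<close>. Windows with \<open>i < n\<close> end before time \<open>m + n\<close>, which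
    fixes the number of generator symbols.\<close>
  define D where "D = (\<lambda>(l, es). map (\<lambda>i. case es ! i of None \<Rightarrow> g (take m (drop i l)) | Some v \<Rightarrow> v) [0..<n])"
  have window: "take m (drop i (itin q (m + n) x)) = itin q m ((f ^^ i) x)" if "i < n" for i x
  proof (rule nth_equalityI)
    show "length (take m (drop i (itin q (m + n) x))) = length (itin q m ((f ^^ i) x))"
      using that by simp
    fix j assume "j < length (take m (drop i (itin q (m + n) x)))"
    then have "j < m" by simp
    moreover have "(f ^^ (i + j)) x = (f ^^ j) ((f ^^ i) x)"
      using funpow_add[of j i f] by (simp add: add.commute)
    ultimately show "take m (drop i (itin q (m + n) x)) ! j = itin q m ((f ^^ i) x) ! j"
      using that by (simp add: itin_def)
  qed
  have eq: "itin c n = D \<circ> (\<lambda>x. (itin q (m + n) x, itin E n x))"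
  proof (rule ext, rule nth_equalityI)
    fix x i
    assume "i < length (itin c n x)"
    then have i: "i < n" by simp
    then have *: "itin c n x ! i = (case itin E n x ! i of None \<Rightarrow> g (itin q m ((f ^^ i) x)) | Some v \<Rightarrow> v)"
      by (simp add: itin_def E)
    have "(D \<circ> (\<lambda>x. (itin q (m + n) x, itin E n x))) x ! i =
        (case itin E n x ! i of None \<Rightarrow> g (itin q m ((f ^^ i) x)) | Some v \<Rightarrow> v)"
      unfolding D_def comp_def prod.case window[OF i, symmetric] using i by (simp del: upt_Suc split: option.split)
    with * show "itin c n x ! i = (D \<circ> (\<lambda>x. (itin q (m + n) x, itin E n x))) x ! i" by simp
  qed (simp add: D_def)
  have "\<H>(itin c n) \<le> \<H>(\<lambda>x. (itin q (m + n) x, itin E n x))"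
    unfolding eq by (rule entropy_data_processing[OF simple_function_Pair[OF sq simple_function_itin[OF sE]]])
  also have "\<dots> \<le> \<H>(itin q (m + n)) + \<H>(itin E n)"
    by (rule entropy_pair_le[OF sq simple_function_itin[OF sE]])
  also have "\<dots> \<le> real (m + n) * \<H>(q) + real n * \<H>(E)"
    by (rule add_mono[OF entropy_itin_le[OF q] entropy_itin_le[OF sE]])
  finally show "\<H>(itin c n) \<le> real (m + n) * \<H>(q) + real n * \<H>(E)" .
qed

section \<open>From partitions to random variables\<close>

definition cell :: "'a set set \<Rightarrow> 'a \<Rightarrow> 'a set" where
  "cell P x = (THE A. A \<in> P \<and> x \<in> A)"

lemma cell_props:
  assumes P: "partition_on (space M) P" and x: "x \<in> space M"
  shows cell_in: "cell P x \<in> P" and cell_eq_iff: "A \<in> P \<Longrightarrow> cell P x = A \<longleftrightarrow> x \<in> A"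
proof -
  obtain B where B: "B \<in> P" "x \<in> B" using x partition_onD1[OF P] by blast
  have uniq: "C = B" if "C \<in> P" "x \<in> C" for C
    using disjointD[OF partition_onD2[OF P] that(1) B(1)] that(2) B(2) by blast
  have eq: "cell P x = B"
    unfolding cell_def
  proof (rule the_equality)
    fix C assume C: "C \<in> P \<and> x \<in> C"
    show "C = B" by (rule uniq) (use C in simp_all)
  qed (use B in simp)
  show "cell P x \<in> P" unfolding eq by (rule B(1))
  assume A: "A \<in> P"
  show "cell P x = A \<longleftrightarrow> x \<in> A" using uniq[OF A] B(2) unfolding eq by metis
qed

lemma simple_function_cell:
  assumes P: "finite_partition M P"
  shows "simple_function M (cell P)"
proof -
  have part: "partition_on (space M) P" and fin: "finite P" and sub: "P \<subseteq> sets M"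
    using P by (auto simp: finite_partition_def)
  show ?thesis
    unfolding simple_function_def
  proof safe
    show "finite (cell P ` space M)"
      by (rule finite_subset[OF _ fin]) (auto intro: cell_in[OF part])
    fix x assume x: "x \<in> space M"
    have "cell P -` {cell P x} \<inter> space M = cell P x"
      using cell_eq_iff[OF part _ cell_in[OF part x]] part cell_in[OF part x]
      by (auto simp: partition_on_def)
    then show "cell P -` {cell P x} \<inter> space M \<in> sets M" using sub cell_in[OF part x] by auto
  qed
qed

text \<open>Cells of the join are the level sets \<open>D l\<close> of the itinerary. Attained
  itineraries have nonempty and therefore distinct level sets, so the sum can be reindexed by them;
  every remaining cell is empty and contributes 0.\<close>

lemma partition_entropy_iterated_join:
  assumes P: "finite_partition M P"
  shows "partition_entropy M (iterated_join M f P n) = \<H>(itin (cell P) n)"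
proof -
  have part: "partition_on (space M) P" and fin: "finite P"
    using P by (auto simp: finite_partition_def)
  have sp: "(f ^^ i) x \<in> space M" if "x \<in> space M" for i x
    by (induction i) (use that measurable_space[OF measurable_map] in auto)
  define C where "C A = {x \<in> space M. \<forall>i<n. (f ^^ i) x \<in> A i}" for A :: "nat \<Rightarrow> 'a set"
  define D where "D l = {x \<in> space M. itin (cell P) n x = l}" for l
  let ?h = "\<lambda>A. measure M A * ln (measure M A)"
  let ?R = "itin (cell P) n ` space M"
  have CD: "C (\<lambda>i\<in>{..<n}. l ! i) = D l" if l: "length l = n" "set l \<subseteq> P" for l
  proof -
    have "itin (cell P) n x = l \<longleftrightarrow> (\<forall>i<n. (f ^^ i) x \<in> l ! i)" if x: "x \<in> space M" for x
    proof -
      have "itin (cell P) n x = l \<longleftrightarrow> (\<forall>i<n. cell P ((f ^^ i) x) = l ! i)"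
        using l(1) by (auto simp: itin_def list_eq_iff_nth_eq)
      moreover have "cell P ((f ^^ i) x) = l ! i \<longleftrightarrow> (f ^^ i) x \<in> l ! i" if "i < n" for i
        by (rule cell_eq_iff[OF part sp[OF x]]) (use l that in auto)
      ultimately show ?thesis by auto
    qed
    then show ?thesis unfolding C_def D_def by auto
  qed
  have DC: "C A = D (map A [0..<n])" if A: "A \<in> {..<n} \<rightarrow>\<^sub>E P" for A
  proof -
    have "C (\<lambda>i\<in>{..<n}. map A [0..<n] ! i) = D (map A [0..<n])"
      by (rule CD) (use A in auto)
    moreover have "C (\<lambda>i\<in>{..<n}. map A [0..<n] ! i) = C A" by (auto simp: C_def)
    ultimately show ?thesis by simp
  qed
  have R: "length l = n \<and> set l \<subseteq> P" if "l \<in> ?R" for l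
    using that cell_in[OF part sp] by (auto simp: itin_def)
  have finJ: "finite (C ` ({..<n} \<rightarrow>\<^sub>E P))" by (intro finite_imageI finite_PiE fin) auto
  have sub: "D ` ?R \<subseteq> C ` ({..<n} \<rightarrow>\<^sub>E P)"
  proof safe
    fix x assume x: "x \<in> space M"
    let ?l = "itin (cell P) n x"
    have l: "length ?l = n" "set ?l \<subseteq> P" using R x by blast+
    show "D ?l \<in> C ` ({..<n} \<rightarrow>\<^sub>E P)"
      unfolding CD[OF l, symmetric] by (rule imageI) (use l in \<open>auto simp: subset_iff\<close>)
  qed
  have "(\<Sum>A\<in>C ` ({..<n} \<rightarrow>\<^sub>E P). ?h A) = (\<Sum>A\<in>D ` ?R. ?h A)"
  proof (rule sum.mono_neutral_right[OF finJ sub], safe)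
    fix A assume A: "A \<in> {..<n} \<rightarrow>\<^sub>E P" "C A \<notin> D ` ?R"
    then have "map A [0..<n] \<notin> ?R" using DC by auto
    then have "C A = {}" unfolding DC[OF A(1)] D_def by (auto simp: image_iff)
    then show "?h (C A) = 0" by simp
  qed
  also have "\<dots> = (\<Sum>l\<in>?R. ?h (D l))"
  proof (rule sum.reindex_cong[OF _ refl refl])
    show "inj_on D ?R" by (rule inj_onI) (auto simp: D_def)
  qed
  finally show ?thesis
    unfolding partition_entropy_def iterated_join_def
    using entropy_eq_sum[OF simple_function_itin[OF simple_function_cell[OF P]]
        simple_functionD(1)[OF simple_function_itin[OF simple_function_cell[OF P]]] subset_refl]
    by (simp add: C_def D_def)
qed

text \<open>Dividing the prediction bound by \<open>n\<close> and letting \<open>n\<close> grow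
  removes the \<open>m\<close> look-ahead symbols. Only afterwards may \<delta> tend to 0, since
  \<open>m\<close> depends on \<delta>.\<close>

lemma metric_entropy_le_generator:
  assumes q: "simple_function M q"
    and gen: "\<And>P \<delta>. finite_partition M P \<Longrightarrow> \<delta> > 0 \<Longrightarrow>
      \<exists>m g. prob {x \<in> space M. cell P x \<noteq> g (itin q m x)} \<le> \<delta>"
  shows "metric_entropy M f \<le> ereal (\<H>(q))"
  unfolding metric_entropy_def
proof (rule SUP_least, safe)
  fix P assume P: "finite_partition M P"
  note c = simple_function_cell[OF P]
  define a where "a n = \<H>(itin (cell P) n)" for n
  have "convergent (\<lambda>n. a n / real n)"
    unfolding a_def
    by (rule fekete_nonneg[OF entropy_itin_add_le[OF c] entropy_nonneg_simple[OF simple_function_itin[OF c]]])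
  then obtain l where l: "(\<lambda>n. a n / real n) \<longlonglongrightarrow> l" by (auto simp: convergent_def)
  have ent: "entropy_wrt M f P = l"
    unfolding entropy_wrt_def partition_entropy_iterated_join[OF P] using limI[OF l] by (simp add: a_def)
  \<comment> \<open>The error process takes at most the values \<open>Some A\<close> with
    \<open>A \<in> P\<close> and the extra value \<open>None\<close>.\<close>
  define N where "N = card P + 1"
  have bound: "l \<le> \<H>(q) + 2 * real N * sqrt \<delta>" if d: "\<delta> > 0" for \<delta>
  proof -
    obtain m g where mg: "prob {x \<in> space M. cell P x \<noteq> g (itin q m x)} \<le> \<delta>"
      using gen[OF P d] by blast
    define E where "E = (\<lambda>x. if cell P x = g (itin q m x) then None else Some (cell P x))"
    note E = entropy_itin_le_prediction[OF c q E_def]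
    have fin: "finite P" and part: "partition_on (space M) P"
      using P by (auto simp: finite_partition_def)
    have "\<H>(E) \<le> 2 * real N * sqrt \<delta>"
    proof (rule entropy_le_of_dominant_value[OF E(1)])
      show "finite (insert None (Some ` P))" using fin by simp
      show "E ` space M \<subseteq> insert None (Some ` P)" using cell_in[OF part] by (auto simp: E_def)
      have "card (insert None (Some ` P)) \<le> Suc (card (Some ` P))" by (rule card_insert_le_m1) auto
      then show "card (insert None (Some ` P)) \<le> N"
        using card_image_le[OF fin, of Some] unfolding N_def by linarith
      have "{x \<in> space M. E x \<noteq> None} = {x \<in> space M. cell P x \<noteq> g (itin q m x)}"
        by (auto simp: E_def)
      then show "prob {x \<in> space M. E x \<noteq> None} \<le> \<delta>" using mg by simp
    qed simp
    then have an: "a n \<le> real (m + n) * \<H>(q) + real n * (2 * real N * sqrt \<delta>)" for n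
      using E(2)[of n] mult_left_mono[of "\<H>(E)" "2 * real N * sqrt \<delta>" "real n"] unfolding a_def by simp
    then have le: "a n / real n \<le> real m * \<H>(q) / real n + (\<H>(q) + 2 * real N * sqrt \<delta>)" if "n > 0" for n
    proof -
      have "a n / real n \<le> (real (m + n) * \<H>(q) + real n * (2 * real N * sqrt \<delta>)) / real n"
        using an by (intro divide_right_mono) auto
      also have "\<dots> = real m * \<H>(q) / real n + (\<H>(q) + 2 * real N * sqrt \<delta>)"
        using that by (simp add: add_divide_distrib distrib_right)
      finally show ?thesis .
    qed
    have "(\<lambda>n. real m * \<H>(q) / real n + (\<H>(q) + 2 * real N * sqrt \<delta>)) \<longlonglongrightarrow>
        0 + (\<H>(q) + 2 * real N * sqrt \<delta>)"
      by (intro tendsto_add tendsto_const lim_const_over_n)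
    moreover have "\<forall>\<^sub>F n in sequentially. a n / real n \<le> real m * \<H>(q) / real n + (\<H>(q) + 2 * real N * sqrt \<delta>)"
      using eventually_gt_at_top[of 0] by eventually_elim (rule le)
    ultimately show ?thesis using tendsto_le[OF _ _ l] by fastforce
  qed
  have "((\<lambda>\<delta>. \<H>(q) + 2 * real N * sqrt \<delta>) \<longlongrightarrow> \<H>(q) + 2 * real N * sqrt 0) (at_right 0)"
    by (intro tendsto_intros)
  moreover have "\<forall>\<^sub>F \<delta> in at_right 0. l \<le> \<H>(q) + 2 * real N * sqrt \<delta>"
    unfolding eventually_at_right_field using bound by (intro exI[of _ 1]) auto
  ultimately have "l \<le> \<H>(q) + 2 * real N * sqrt 0"
    by (rule tendsto_lowerbound) simp
  then show "ereal (entropy_wrt M f P) \<le> ereal (\<H>(q))" by (simp add: ent)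
qed

text \<open>The one-cell partition competes in the supremum; all its iterated joins consist of a
  single cell of probability 1.\<close>

lemma metric_entropy_nonneg: "0 \<le> metric_entropy M f"
proof -
  have sp: "(f ^^ i) x \<in> space M" if "x \<in> space M" for i x
    by (induction i) (use that measurable_space[OF measurable_map] in auto)
  have "iterated_join M f {space M} n = {space M}" for n
  proof -
    have "{..<n} \<rightarrow>\<^sub>E {space M} = {\<lambda>i\<in>{..<n}. space M}"
      by (auto simp: PiE_def extensional_def fun_eq_iff)
    then show ?thesis by (simp add: iterated_join_def) (use sp in blast)
  qed
  then have "entropy_wrt M f {space M} = 0"
    by (simp add: entropy_wrt_def partition_entropy_def prob_space)
  moreover have "finite_partition M {space M}"
    using not_empty by (simp add: finite_partition_def partition_on_def)
  ultimately show ?thesis unfolding metric_entropy_def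
    by (intro SUP_upper2[of "{space M}"]) (auto simp: zero_ereal_def)
qed

end


section \<open>Inverse lifts with bounded distortion\<close>

locale inverse_lift =
  fixes d :: nat and G p :: "real \<Rightarrow> real" and L m :: real
  assumes d_ge: "d \<ge> 2"
    and deriv: "\<And>x. (G has_real_derivative p x) (at x)"
    and G_0 [simp]: "G 0 = 0"
    and p_sum: "\<And>x. (\<Sum>i<d. p (x + real i)) = 1"
    and m_pos: "0 < m" and p_ge: "\<And>x. m \<le> p x"
    and L_pos: "0 < L" and p_distortion: "\<And>x y. p x \<le> exp (L * \<bar>x - y\<bar>) * p y"
begin

lemma p_pos: "0 < p x"
  using m_pos p_ge[of x] by linarith

text \<open>Since \<open>d \<ge> 2\<close>, a second branch takes at least \<open>m\<close> of the
  total weight 1. This makes \<open>G\<close> a contraction with factor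
  \<open>1 - m\<close>.\<close>

lemma p_le: "p x \<le> 1 - m"
proof -
  have "(\<Sum>i\<in>{0, 1}. p (x + real i)) \<le> (\<Sum>i<d. p (x + real i))"
    using d_ge p_pos by (intro sum_mono2) (auto intro: less_imp_le)
  then have "p x + p (x + 1) \<le> 1" using p_sum[of x] by simp
  then show ?thesis using p_ge[of "x + 1"] by linarith
qed

lemma m_less: "m < 1"
  using p_le[of 0] p_pos[of 0] by linarith

lemma G_mvt:
  assumes "x < y"
  obtains z where "x < z" "z < y" "G y - G x = (y - x) * p z"
  using MVT2[OF assms, of G p] deriv by blast

lemma G_strict_mono: "strict_mono G"
proof (rule strict_monoI)
  fix x y :: real assume "x < y"
  then obtain z where "G y - G x = (y - x) * p z" by (rule G_mvt)
  moreover have "(y - x) * p z > 0" using \<open>x < y\<close> p_pos by simp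
  ultimately show "G x < G y" by linarith
qed

lemma G_less_iff [simp]: "G x < G y \<longleftrightarrow> x < y"
  by (rule strict_mono_less[OF G_strict_mono])

lemma G_le_iff [simp]: "G x \<le> G y \<longleftrightarrow> x \<le> y"
  by (rule strict_mono_less_eq[OF G_strict_mono])

lemma G_eq_iff [simp]: "G x = G y \<longleftrightarrow> x = y"
  by (rule strict_mono_eq[OF G_strict_mono])

lemma G_diff_le: "x \<le> y \<Longrightarrow> G y - G x \<le> (1 - m) * (y - x)"
proof (cases "x = y")
  case False
  assume "x \<le> y"
  with False have "x < y" by simp
  then obtain z where "G y - G x = (y - x) * p z" by (rule G_mvt)
  moreover have "(y - x) * p z \<le> (y - x) * (1 - m)"
    using \<open>x < y\<close> p_le by (intro mult_left_mono) auto
  ultimately show ?thesis by (simp add: mult.commute)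
qed simp

lemma G_diff_ge: "x \<le> y \<Longrightarrow> m * (y - x) \<le> G y - G x"
proof (cases "x = y")
  case False
  assume "x \<le> y"
  with False have "x < y" by simp
  then obtain z where "G y - G x = (y - x) * p z" by (rule G_mvt)
  moreover have "(y - x) * m \<le> (y - x) * p z"
    using \<open>x < y\<close> p_ge by (intro mult_left_mono) auto
  ultimately show ?thesis by (simp add: mult.commute)
qed simp

lemma G_continuous: "continuous_on S G"
  by (rule DERIV_continuous_on) (rule has_field_derivative_at_within[OF deriv])

text \<open>The integrated form of \<open>p_sum\<close>: for positive \<open>x\<close>, the images
  of \<open>[0, x]\<close> under the \<open>d\<close> inverse branches have total length
  \<open>x\<close>. The difference of the two sides has derivative 0 and vanishes at 0.\<close>

lemma G_branch_sum: "(\<Sum>i<d. G (x + real i) - G (real i)) = x"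
proof -
  define S where "S x = (\<Sum>i<d. G (x + real i)) - x" for x
  have "(S has_real_derivative 0) (at x)" for x
  proof -
    have "((\<lambda>x. G (x + real i)) has_real_derivative p (x + real i)) (at x)" for i
      using DERIV_shift[of G "p (x + real i)" x "real i"] deriv by simp
    then have "(S has_real_derivative (\<Sum>i<d. p (x + real i)) - 1) (at x)"
      unfolding S_def by (intro DERIV_diff DERIV_sum DERIV_ident) auto
    then show ?thesis by (simp add: p_sum)
  qed
  then have "S x = S 0" by (intro DERIV_isconst_all) auto
  then show ?thesis by (simp add: S_def sum_subtractf)
qed

text \<open>Subtracting the branch sums at \<open>x\<close> and \<open>x + 1\<close> telescopes. The
  degree of the map is thus a consequence of \<open>p_sum\<close>, and no periodicity of
  \<open>p\<close> has to be assumed.\<close>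

lemma G_add_d: "G (x + real d) = G x + 1"
proof -
  define f where "f i = G (x + real i)" for i
  have "(\<Sum>i<d. f (Suc i)) - (\<Sum>i<d. f i) = 1"
    using G_branch_sum[of "x + 1"] G_branch_sum[of x]
    by (simp add: f_def sum_subtractf add_ac)
  moreover have "(\<Sum>i<d. f (Suc i)) + f 0 = (\<Sum>i<d. f i) + f d"
    using sum.lessThan_Suc_shift[of f d] by simp
  ultimately show ?thesis by (simp add: f_def)
qed

lemma G_add_mult_d: "G (x + real k * real d) = G x + real k"
proof (induction k)
  case (Suc k)
  have "x + real (Suc k) * real d = x + real k * real d + real d" by (simp add: algebra_simps)
  then show ?case using Suc G_add_d[of "x + real k * real d"] by (simp only: of_nat_Suc)
qed simp

lemma G_d: "G (real d) = 1"
  using G_add_d[of 0] by simp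

lemma G_surj: "surj G"
proof -
  have "\<exists>x. y = G x" for y
  proof -
    obtain k :: nat where k: "\<bar>y\<bar> \<le> real k" using real_arch_simple by blast
    let ?b = "real k * real d"
    have "G ?b = real k" using G_add_mult_d[of 0 k] by simp
    moreover have "G (- ?b) = - real k" using G_add_mult_d[of "- ?b" k] by simp
    ultimately have "\<exists>x\<ge>- ?b. x \<le> ?b \<and> G x = y"
      using k by (intro IVT') (auto intro: G_continuous)
    then show ?thesis by blast
  qed
  then show ?thesis unfolding surj_def by blast
qed

lemma G_bij: "bij G"
  using G_surj strict_mono_imp_inj_on[OF G_strict_mono] by (simp add: bij_def)

definition F :: "real \<Rightarrow> real" where "F = inv G"

lemma F_G [simp]: "F (G x) = x"
  unfolding F_def by (rule inv_f_f[OF bij_is_inj[OF G_bij]])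

lemma G_F [simp]: "G (F x) = x"
  unfolding F_def by (rule surj_f_inv_f[OF G_surj])

lemma inv_F: "inv F = G"
  unfolding F_def by (rule inv_inv_eq[OF G_bij])

lemma F_0 [simp]: "F 0 = 0"
  using F_G[of 0] by simp

lemma F_strict_mono: "strict_mono F"
proof (rule strict_monoI)
  fix x y :: real assume "x < y"
  then have "G (F x) < G (F y)" by simp
  then show "F x < F y" by (simp only: G_less_iff)
qed

lemma F_continuous: "continuous_on S F"
proof -
  have "\<bar>F x - F y\<bar> \<le> \<bar>x - y\<bar> / m" for x y
    using G_diff_ge[of "F x" "F y"] G_diff_ge[of "F y" "F x"] m_pos
    by (auto simp: field_simps abs_if not_le)
  then have "(1 / m)-lipschitz_on UNIV F"
    using m_pos by (intro lipschitz_onI) (auto simp: dist_real_def)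
  then have "continuous_on UNIV F" by (rule lipschitz_on_continuous_on)
  then show ?thesis by (rule continuous_on_subset) simp
qed

lemma F_add_1: "F (x + 1) = F x + real d"
  using G_add_d[of "F x"] F_G[of "F x + real d"] by simp

lemma F_homeomorphism: "homeomorphism UNIV UNIV F (inv F)"
  unfolding inv_F
  by (intro homeomorphismI F_continuous G_continuous) auto

section \<open>Bounded distortion of the iterates\<close>

lemma iter_less_iff [simp]: "(G ^^ n) x < (G ^^ n) y \<longleftrightarrow> x < y"
  by (induction n) auto

lemma iter_le_iff [simp]: "(G ^^ n) x \<le> (G ^^ n) y \<longleftrightarrow> x \<le> y"
  by (induction n) auto

lemma iter_add_power: "(G ^^ n) (x + real k * real d ^ n) = (G ^^ n) x + real k"
proof (induction n arbitrary: x)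
  case (Suc n)
  have "G (x + real k * real d ^ Suc n) = G x + real k * real d ^ n"
    using G_add_mult_d[of x "k * d ^ n"] by (simp add: mult_ac)
  then show ?case using Suc by (simp add: funpow_swap1)
qed simp

text \<open>The distortions picked up along the first \<open>n\<close> iterates form a geometric series with
  ratio \<open>1 - m\<close>, whence the constant \<open>L / m\<close>.\<close>

lemma iter_distortion:
  assumes "a < b" "a' < b'" "b - a' \<le> l" "b' - a \<le> l"
  shows "((G ^^ n) b - (G ^^ n) a) * (b' - a') \<le> exp (L / m * l) * (b - a) * ((G ^^ n) b' - (G ^^ n) a')"
  using assms
proof (induction n arbitrary: a b a' b' l)
  case 0
  then have "0 \<le> l" by linarith
  then have "1 \<le> exp (L / m * l)" using L_pos m_pos by simp
  then have "1 * ((b - a) * (b' - a')) \<le> exp (L / m * l) * ((b - a) * (b' - a'))"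
    using 0 by (intro mult_right_mono) auto
  then show ?case by (simp add: mult_ac)
next
  case (Suc n)
  have l: "0 \<le> l" using Suc.prems by linarith
  \<comment> \<open>The number \<open>l\<close> bounds how far either interval reaches beyond the
    left end of the other, and \<open>G\<close> shrinks this reach by the factor
    \<open>1 - m\<close>. If \<open>y < x\<close> the difference is negative and nothing has to be
    shown.\<close>
  have contr: "G y - G x \<le> (1 - m) * l" if "y - x \<le> l" for x y
  proof (cases "x \<le> y")
    case True
    have "(1 - m) * (y - x) \<le> (1 - m) * l" using that m_less by (intro mult_left_mono) auto
    with G_diff_le[OF True] show ?thesis by linarith
  next
    case False
    then have "G y < G x" by simp
    moreover have "0 \<le> (1 - m) * l" using l m_less by simp
    ultimately show ?thesis by linarith
  qed
  define X where "X = (G ^^ Suc n) b - (G ^^ Suc n) a"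
  define Y where "Y = (G ^^ Suc n) b' - (G ^^ Suc n) a'"
  have Y: "Y > 0" using Suc.prems by (simp add: Y_def)
  obtain z where z: "a < z" "z < b" "G b - G a = (b - a) * p z"
    using Suc.prems(1) by (rule G_mvt)
  obtain z' where z': "a' < z'" "z' < b'" "G b' - G a' = (b' - a') * p z'"
    using Suc.prems(2) by (rule G_mvt)
  have "\<bar>z - z'\<bar> \<le> l" using z z' Suc.prems by linarith
  then have "exp (L * \<bar>z - z'\<bar>) * p z' \<le> exp (L * l) * p z'"
    using L_pos p_pos[of z'] by (intro mult_right_mono) auto
  then have "p z \<le> exp (L * l) * p z'" using p_distortion[of z z'] by linarith
  then have "(b - a) * (b' - a') * p z \<le> (b - a) * (b' - a') * (exp (L * l) * p z')"
    using Suc.prems by (intro mult_left_mono) auto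
  then have one: "(G b - G a) * (b' - a') \<le> exp (L * l) * (b - a) * (G b' - G a')"
    unfolding z(3) z'(3) by (simp add: mult_ac)
  have "X * (G b' - G a') \<le> exp (L / m * ((1 - m) * l)) * (G b - G a) * Y"
    using Suc.IH[of "G a" "G b" "G a'" "G b'" "(1 - m) * l"] Suc.prems contr
    by (simp add: X_def Y_def funpow_swap1)
  then have "X * (G b' - G a') * (b' - a') \<le> exp (L / m * ((1 - m) * l)) * (G b - G a) * Y * (b' - a')"
    using Suc.prems by (intro mult_right_mono) auto
  also have "\<dots> = exp (L / m * ((1 - m) * l)) * Y * ((G b - G a) * (b' - a'))" by simp
  also have "\<dots> \<le> exp (L / m * ((1 - m) * l)) * Y * (exp (L * l) * (b - a) * (G b' - G a'))"
    using one Y by (intro mult_left_mono) auto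
  also have "\<dots> = exp (L / m * ((1 - m) * l) + L * l) * (b - a) * Y * (G b' - G a')"
    by (simp add: exp_add)
  also have "L / m * ((1 - m) * l) + L * l = L / m * l" using m_pos by (simp add: field_simps)
  finally have "(X * (b' - a')) * (G b' - G a') \<le> (exp (L / m * l) * (b - a) * Y) * (G b' - G a')"
    by (simp add: mult_ac)
  then have "X * (b' - a') \<le> exp (L / m * l) * (b - a) * Y"
    using Suc.prems by (simp add: mult_le_cancel_right)
  then show ?case by (simp add: X_def Y_def)
qed

text \<open>Two adjacent intervals of length \<open>t\<close> span \<open>2 * t\<close>, which is
  the length entering the distortion estimate. From \<open>t = 1\<close> on only boundedness is
  required, and the constant is the one of \<open>iter_ratio_large\<close>.\<close>

definition modulus :: "real \<Rightarrow> real" where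
  "modulus t = (if t < 1 then exp (L / m * (2 * t)) - 1 else real d * exp (L / m * (2 * real d)))"

lemma modulus_pos: "t > 0 \<Longrightarrow> modulus t > 0"
  using L_pos m_pos d_ge by (simp add: modulus_def)

lemma symmetry_modulus_modulus: "symmetry_modulus modulus"
  unfolding symmetry_modulus_def
proof (intro conjI allI impI)
  show "modulus t > 0" if "t > 0" for t by (rule modulus_pos[OF that])
  have "\<bar>modulus t\<bar> \<le> exp (L / m * 2) + real d * exp (L / m * (2 * real d))" if "t > 0" for t
  proof (cases "t < 1")
    case True
    have "exp (L / m * (2 * t)) \<le> exp (L / m * 2)"
      unfolding exp_le_cancel_iff using True L_pos m_pos by (intro mult_left_mono) auto
    moreover have "0 \<le> real d * exp (L / m * (2 * real d))" by simp
    moreover have "modulus t = exp (L / m * (2 * t)) - 1" using True by (simp add: modulus_def)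
    ultimately show ?thesis using modulus_pos[OF that] by linarith
  qed (simp add: modulus_def abs_mult)
  then show "bounded (modulus ` {0<..})" by (auto simp: bounded_iff)
  have "((\<lambda>t. exp (L / m * (2 * t)) - 1) \<longlongrightarrow> exp (L / m * (2 * 0)) - 1) (at_right 0)"
    by (intro tendsto_intros)
  moreover have "\<forall>\<^sub>F t in at_right 0. exp (L / m * (2 * t)) - 1 = modulus t"
    unfolding eventually_at_right_field by (intro exI[of _ 1]) (auto simp: modulus_def)
  ultimately show "(modulus \<longlongrightarrow> 0) (at_right 0)"
    by (simp add: tendsto_cong)
qed

text \<open>The alternative in the hypothesis stands for the two orders of the adjacent intervals at
  \<open>x\<close>, so that one statement gives both the upper and the lower bound of the
  ratio.\<close>

lemma iter_ratio_small:
  assumes t: "0 < t" and ab: "(a = x \<and> a' = x - t) \<or> (a = x - t \<and> a' = x)"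
  shows "(G ^^ n) (a + t) - (G ^^ n) a \<le> exp (L / m * (2 * t)) * ((G ^^ n) (a' + t) - (G ^^ n) a')"
proof -
  have "((G ^^ n) (a + t) - (G ^^ n) a) * t \<le>
      (exp (L / m * (2 * t)) * ((G ^^ n) (a' + t) - (G ^^ n) a')) * t"
    using iter_distortion[of a "a + t" a' "a' + t" "2 * t" n] t ab by (auto simp: mult_ac)
  then show ?thesis using t by (simp add: mult_le_cancel_right)
qed

text \<open>At large scales one first applies \<open>G\<close> until the scale drops below the period, where
  the lengths are controlled by the periodicity alone.\<close>

lemma iter_ratio_large:
  assumes t: "1 \<le> t" and ab: "(a = x \<and> a' = x - t) \<or> (a = x - t \<and> a' = x)"
  shows "(G ^^ n) (a + t) - (G ^^ n) a \<le>
    real d * exp (L / m * (2 * real d)) * ((G ^^ n) (a' + t) - (G ^^ n) a')"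
proof -
  \<comment> \<open>The exponent \<open>k\<close> is the largest one up to \<open>n\<close> whose
    period \<open>d ^ k\<close> still fits into \<open>t\<close>.\<close>
  have "\<exists>k\<le>n. real d ^ k \<le> t \<and> (k = n \<or> t < real d ^ Suc k)"
  proof (induction n)
    case (Suc n)
    then obtain k where "k \<le> n" "real d ^ k \<le> t" "k = n \<or> t < real d ^ Suc k" by blast
    then show ?case by (cases "k = n \<and> real d ^ Suc n \<le> t") (auto intro: exI[of _ "Suc n"] exI[of _ k])
  qed (use t in simp)
  then obtain k where k: "k \<le> n" "real d ^ k \<le> t" "k = n \<or> t < real d ^ Suc k" by blast
  \<comment> \<open>An interval of length \<open>t\<close> contains \<open>q\<close> full periods of
    length \<open>d ^ k\<close> and less than \<open>q + 1\<close>, so its image under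
    \<open>k\<close> iterates has length between \<open>q\<close> and \<open>q + 1\<close>.\<close>
  define q where "q = nat \<lfloor>t / real d ^ k\<rfloor>"
  have dk: "0 < real d ^ k" using d_ge by simp
  have q1: "1 \<le> t / real d ^ k" using k(2) dk by simp
  then have q: "real q \<le> t / real d ^ k" "t / real d ^ k < real q + 1" "1 \<le> q"
    unfolding q_def by linarith+
  have "1 \<le> real q" using q(3) by simp
  have qt: "real q * real d ^ k \<le> t" "t \<le> real (Suc q) * real d ^ k"
    using q dk by (simp_all add: field_simps)
  have len: "real q \<le> (G ^^ k) (y + t) - (G ^^ k) y \<and> (G ^^ k) (y + t) - (G ^^ k) y \<le> real q + 1" for y
  proof -
    have "(G ^^ k) (y + real q * real d ^ k) \<le> (G ^^ k) (y + t)" using qt by simp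
    moreover have "(G ^^ k) (y + t) \<le> (G ^^ k) (y + real (Suc q) * real d ^ k)"
      using qt by (simp only: iter_le_iff)
    ultimately show ?thesis
      unfolding iter_add_power by simp
  qed
  define E where "E = exp (L / m * (2 * real d))"
  have E: "1 \<le> E" using L_pos m_pos unfolding E_def by simp
  define V where "V = (G ^^ n) (a' + t) - (G ^^ n) a'"
  have V: "0 < V" using t by (simp add: V_def)
  show ?thesis
  proof (cases "k = n")
    \<comment> \<open>No iterates remain: the ratio is at most
      \<open>(q + 1) / q \<le> 2 \<le> d\<close>.\<close>
    case True
    have "(G ^^ n) (a + t) - (G ^^ n) a \<le> real q + 1" using len[of a] True by simp
    also have "\<dots> \<le> 2 * real q" using \<open>1 \<le> real q\<close> by simp
    also have "\<dots> \<le> 2 * V" using len[of a'] True by (simp add: V_def)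
    also have "2 * V \<le> (real d * E) * V"
      using V E d_ge mult_mono[of 2 "real d" 1 E] by (intro mult_right_mono) auto
    finally show ?thesis by (simp add: E_def V_def)
  next
    \<comment> \<open>Here \<open>q < d\<close>, so after \<open>k\<close> steps both lengths lie
      between 1 and \<open>d\<close>. The remaining \<open>n - k\<close> iterates act on intervals
      spanning at most \<open>2 * d\<close>, where the distortion estimate applies.\<close>
    case False
    then have "t < real d * real d ^ k" using k(3) by simp
    then have "t / real d ^ k < real d" using dk by (simp add: field_simps)
    then have "real q < real d" using q(1) by linarith
    then have qd: "real q + 1 \<le> real d" by simp
    define H where "H y = (G ^^ k) y" for y
    have split: "(G ^^ n) y = (G ^^ (n - k)) (H y)" for y
      using k(1) funpow_add[of "n - k" k G] by (simp add: H_def)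
    have lenH: "1 \<le> H (y + t) - H y" "H (y + t) - H y \<le> real d" for y
      using len[of y] q(3) qd by (auto simp: H_def)
    define U where "U = (G ^^ n) (a + t) - (G ^^ n) a"
    have "U * (H (a' + t) - H a') \<le> E * (H (a + t) - H a) * V"
      unfolding U_def V_def split E_def
    proof (rule iter_distortion)
      show "H a < H (a + t)" "H a' < H (a' + t)" using t by (auto simp: H_def)
      have HH: "H (x + t) - H (x - t) \<le> 2 * real d" using lenH(2)[of x] lenH(2)[of "x - t"] by simp
      show "H (a + t) - H a' \<le> 2 * real d" "H (a' + t) - H a \<le> 2 * real d"
        using HH ab d_ge by auto
    qed
    moreover have "U * 1 \<le> U * (H (a' + t) - H a')"
      using lenH(1)[of a'] t by (intro mult_left_mono) (auto simp: U_def)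
    moreover have "E * (H (a + t) - H a) * V \<le> E * real d * V"
      using lenH(2)[of a] E V by (intro mult_right_mono mult_left_mono) auto
    ultimately have "U \<le> real d * E * V" by (simp add: mult_ac)
    then show ?thesis by (simp add: U_def V_def E_def)
  qed
qed

lemma symmetric_with_iter: "symmetric_with modulus (G ^^ n)"
  unfolding symmetric_with_def
proof (intro allI impI)
  fix x t :: real assume t: "t > 0"
  define u where "u = (G ^^ n) (x + t) - (G ^^ n) x"
  define v where "v = (G ^^ n) x - (G ^^ n) (x - t)"
  have pos: "u > 0" "v > 0" using t by (auto simp: u_def v_def)
  have K: "1 + modulus t > 0" using modulus_pos[OF t] by simp
  have "u \<le> (1 + modulus t) * v \<and> v \<le> (1 + modulus t) * u"
  proof (cases "t < 1")
    case True
    then show ?thesis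
      using iter_ratio_small[OF t, of x x "x - t" n] iter_ratio_small[OF t, of "x - t" x x n]
      by (simp add: u_def v_def modulus_def)
  next
    case False
    then have "u \<le> modulus t * v \<and> v \<le> modulus t * u"
      using iter_ratio_large[of t x x "x - t" n] iter_ratio_large[of t "x - t" x x n]
      by (simp add: u_def v_def modulus_def)
    with pos show ?thesis by (simp add: algebra_simps)
  qed
  then have "1 / (1 + modulus t) \<le> u / v \<and> u / v \<le> 1 + modulus t"
    using pos K by (simp add: field_simps)
  then show "1 / (1 + modulus t) \<le> \<bar>(G ^^ n) (x + t) - (G ^^ n) x\<bar> / \<bar>(G ^^ n) x - (G ^^ n) (x - t)\<bar> \<and>
      \<bar>(G ^^ n) (x + t) - (G ^^ n) x\<bar> / \<bar>(G ^^ n) x - (G ^^ n) (x - t)\<bar> \<le> 1 + modulus t"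
    using pos by (simp add: u_def v_def)
qed

end


section \<open>Lebesgue measure on the circle\<close>

definition turn :: "real \<Rightarrow> complex" where "turn x = cis (2 * pi * x)"

definition angle :: "complex \<Rightarrow> real" where "angle z = Arg2pi z / (2 * pi)"

lemma turn_in_circle [simp]: "norm (turn x) = 1"
  by (simp add: turn_def)

lemma turn_0 [simp]: "turn 0 = 1"
  by (simp add: turn_def)

lemma turn_add_int [simp]: "turn (x + of_int k) = turn x"
proof -
  have "turn (x + of_int k) = cis (2 * pi * x) * cis (2 * pi * of_int k)"
    unfolding turn_def cis_mult distrib_left ..
  then show ?thesis unfolding turn_def by simp
qed

lemma turn_add_nat [simp]: "turn (x + real k) = turn x"
  using turn_add_int[of x "int k"] by simp

lemma turn_frac [simp]: "turn (frac x) = turn x"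
  using turn_add_int[of "frac x" "\<lfloor>x\<rfloor>"] by (simp add: frac_def)

lemma angle_bounds: "0 \<le> angle z" "angle z < 1"
  using Arg2pi[of z] by (auto simp: angle_def)

lemma turn_angle: "norm z = 1 \<Longrightarrow> turn (angle z) = z"
  using complex_norm_eq_1_exp[of z] by (simp add: turn_def angle_def cis_conv_exp)

lemma angle_turn: "angle (turn x) = frac x"
proof -
  have "Arg2pi (turn (frac x)) = 2 * pi * frac x"
    unfolding turn_def cis_conv_exp
    using Arg2pi_exp[of "\<i> * complex_of_real (2 * pi * frac x)"] frac_lt_1[of x] by simp
  then show ?thesis by (simp add: angle_def)
qed

lemma turn_eq_iff: "turn x = turn y \<longleftrightarrow> (\<exists>k::int. x = y + of_int k)"
proof
  assume "turn x = turn y"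
  then have "frac x = frac y" using angle_turn[of x] angle_turn[of y] by simp
  then have "x = y + of_int (\<lfloor>x\<rfloor> - \<lfloor>y\<rfloor>)" by (simp add: frac_def)
  then show "\<exists>k::int. x = y + of_int k" by blast
qed auto

lemma turn_continuous: "continuous_on S turn"
  unfolding turn_def by (intro continuous_intros)

section \<open>Local inverses of the covering of the circle by the line\<close>

text \<open>Division by \<open>turn a\<close> rotates the cut of \<open>Arg\<close> to the antipode
  of \<open>turn a\<close>, giving the continuous inverse of \<open>turn\<close> on the unit
  interval centred at \<open>a\<close>.\<close>

definition turn_branch :: "real \<Rightarrow> complex \<Rightarrow> real" where
  "turn_branch a w = a + Arg (w / turn a) / (2 * pi)"

lemma turn_divide: "turn x / turn a = turn (x - a)"
  by (simp add: turn_def cis_divide right_diff_distrib)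

lemma turn_branch_turn:
  assumes "\<bar>x - a\<bar> < 1 / 2"
  shows "turn_branch a (turn x) = x"
proof -
  have "x - a < 1 / 2" "- (1 / 2) < x - a" using assms by linarith+
  then have "(x - a) * (2 * pi) < 1 / 2 * (2 * pi)" "- (1 / 2) * (2 * pi) < (x - a) * (2 * pi)"
    by (intro mult_strict_right_mono; simp)+
  then have "2 * pi * (x - a) \<in> {-pi<..pi}" by (simp add: mult_ac)
  then have "Arg (turn (x - a)) = 2 * pi * (x - a)" unfolding turn_def by (rule Arg_cis)
  then show ?thesis by (simp add: turn_branch_def turn_divide)
qed

lemma turn_homeomorphism:
  "homeomorphism {a - 1 / 2<..<a + 1 / 2} (turn ` {a - 1 / 2<..<a + 1 / 2}) turn (turn_branch a)"
proof (rule homeomorphismI)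
  have inv: "turn_branch a (turn x) = x" if "x \<in> {a - 1 / 2<..<a + 1 / 2}" for x
    by (rule turn_branch_turn) (use that in \<open>auto simp: abs_if\<close>)
  have "turn x / turn a \<notin> \<real>\<^sub>\<le>\<^sub>0" if x: "x \<in> {a - 1 / 2<..<a + 1 / 2}" for x
  proof
    assume "turn x / turn a \<in> \<real>\<^sub>\<le>\<^sub>0"
    then obtain r where r: "r \<le> 0" "turn (x - a) = of_real r"
      by (auto simp: turn_divide elim!: nonpos_Reals_cases)
    have "\<bar>r\<bar> = 1" using arg_cong[OF r(2), of norm] by simp
    then have "turn (x - a) = turn (1 / 2)" using r by (simp add: turn_def)
    then obtain k :: int where k: "x - a = 1 / 2 + of_int k" using turn_eq_iff by blast
    then have "- 1 < real_of_int k" "real_of_int k < 0" using x by auto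
    then have "\<bar>real_of_int k\<bar> < 1" by linarith
    then show False using \<open>real_of_int k < 0\<close> by simp
  qed
  then show "continuous_on (turn ` {a - 1 / 2<..<a + 1 / 2}) (turn_branch a)"
    unfolding turn_branch_def
    by (intro continuous_intros) (auto simp: turn_def)
  show "turn_branch a ` turn ` {a - 1 / 2<..<a + 1 / 2} \<subseteq> {a - 1 / 2<..<a + 1 / 2}"
    by (auto simp: inv)
qed (use turn_continuous turn_branch_turn in \<open>auto simp: abs_if\<close>)

lemma turn_image_unit: "turn ` {a - 1 / 2<..<a + 1 / 2} = circle - {turn (a + 1 / 2)}"
proof safe
  fix x assume x: "x \<in> {a - 1 / 2<..<a + 1 / 2}"
  show "turn x \<in> circle" by simp
  assume "turn x = turn (a + 1 / 2)"
  then obtain k :: int where k: "x = a + 1 / 2 + of_int k" using turn_eq_iff by blast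
  then have "- 1 < real_of_int k" "real_of_int k < 0" using x by auto
  then have "\<bar>real_of_int k\<bar> < 1" by linarith
  then show False using \<open>real_of_int k < 0\<close> by simp
next
  fix w assume w: "w \<in> circle" "w \<notin> turn ` {a - 1 / 2<..<a + 1 / 2}"
  define x where "x = a - 1 / 2 + frac (angle w - (a - 1 / 2))"
  have "turn x = turn (angle w)"
    unfolding turn_eq_iff x_def by (intro exI[of _ "- \<lfloor>angle w - (a - 1 / 2)\<rfloor>"]) (simp add: frac_def)
  then have tx: "turn x = w" using turn_angle w by simp
  have "a - 1 / 2 \<le> x" "x < a + 1 / 2"
    using frac_ge_0[of "angle w - (a - 1 / 2)"] frac_lt_1[of "angle w - (a - 1 / 2)"] by (auto simp: x_def)
  with w tx have "x = a - 1 / 2" by force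
  then show "w = turn (a + 1 / 2)"
    using tx turn_add_int[of "a - 1 / 2" 1] by (simp add: add.commute)
qed

lemma turn_image_unit_open: "openin (top_of_set circle) (turn ` {a - 1 / 2<..<a + 1 / 2})"
  unfolding turn_image_unit
  using openin_open_Int[of "- {turn (a + 1 / 2)}" circle] by (simp add: Diff_eq open_Compl)

lemma turn_image_open:
  assumes "open S" "S \<subseteq> {a - 1 / 2<..<a + 1 / 2}"
  shows "openin (top_of_set circle) (turn ` S)"
proof -
  have "openin (top_of_set {a - 1 / 2<..<a + 1 / 2}) S"
    using assms by (simp add: openin_open_eq)
  then have "openin (top_of_set (turn ` {a - 1 / 2<..<a + 1 / 2})) (turn ` S)"
    by (rule homeomorphism_imp_open_map[OF turn_homeomorphism])
  then show ?thesis using turn_image_unit_open openin_trans by blast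
qed

section \<open>Normalised Lebesgue measure\<close>

definition turn_measure :: "real measure" where
  "turn_measure = uniform_measure lborel {0..<1}"

definition circle_lebesgue :: "complex measure" where
  "circle_lebesgue = distr turn_measure (restrict_space borel circle) turn"

lemma sets_turn_measure [simp, measurable_cong]: "sets turn_measure = sets borel"
  by (simp add: turn_measure_def)

lemma space_turn_measure [simp]: "space turn_measure = UNIV"
  by (simp add: turn_measure_def)

lemma prob_space_turn_measure: "prob_space turn_measure"
  unfolding turn_measure_def by (rule prob_space_uniform_measure) auto

lemma measure_turn_measure:
  "A \<in> sets borel \<Longrightarrow> measure turn_measure A = measure lborel ({0..<1} \<inter> A)"
  unfolding turn_measure_def by (subst measure_uniform_measure) auto

lemma turn_measurable [measurable]: "turn \<in> measurable turn_measure (restrict_space borel circle)"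
  by (intro measurable_restrict_space2)
    (auto intro!: borel_measurable_continuous_onI turn_continuous simp: measurable_cong_sets[OF sets_turn_measure refl])

lemma space_circle_lebesgue [simp]: "space circle_lebesgue = circle"
  by (simp add: circle_lebesgue_def space_restrict_space)

lemma sets_circle_lebesgue [simp, measurable_cong]:
  "sets circle_lebesgue = sets (restrict_space borel circle)"
  by (simp add: circle_lebesgue_def)

lemma prob_space_circle_lebesgue: "prob_space circle_lebesgue"
  unfolding circle_lebesgue_def by (rule prob_space.prob_space_distr[OF prob_space_turn_measure turn_measurable])

lemma measure_circle_lebesgue:
  assumes "A \<in> sets circle_lebesgue"
  shows "turn -` A \<in> sets borel" "measure circle_lebesgue A = measure lborel {x \<in> {0..<1}. turn x \<in> A}"
proof -
  have A: "A \<in> sets (restrict_space borel circle)" using assms by simp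
  show *: "turn -` A \<in> sets borel" using measurable_sets[OF turn_measurable A] by simp
  have "measure circle_lebesgue A = measure turn_measure (turn -` A)"
    unfolding circle_lebesgue_def by (simp add: measure_distr[OF turn_measurable A])
  also have "\<dots> = measure lborel {x \<in> {0..<1}. turn x \<in> A}"
    unfolding measure_turn_measure[OF *] by (rule arg_cong[where f = "measure lborel"]) auto
  finally show "measure circle_lebesgue A = measure lborel {x \<in> {0..<1}. turn x \<in> A}" .
qed

text \<open>Within the fundamental domain \<open>[0, 1)\<close> the arc from 1 to \<open>z\<close>
  pulls back to \<open>{0..angle z}\<close>, of length \<open>angle z\<close>.\<close>

lemma dist_fun_circle_lebesgue: "dist_fun circle_lebesgue = restrict id circle"
proof
  fix z
  show "dist_fun circle_lebesgue z = restrict id circle z"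
  proof (cases "z \<in> circle")
    case True
    have "{w. Arg2pi w \<le> Arg2pi z} \<in> sets borel" by (intro borel_closed closed_Arg2pi2pi_le)
    then have "circle \<inter> {w. Arg2pi w \<le> Arg2pi z} \<in> sets (restrict_space borel circle)"
      by (subst sets_restrict_space) blast
    moreover have "circle \<inter> {w. Arg2pi w \<le> Arg2pi z} = arc_from_one z" by (auto simp: arc_from_one_def)
    ultimately have arc: "arc_from_one z \<in> sets circle_lebesgue" by simp
    have "turn x \<in> arc_from_one z \<longleftrightarrow> x \<le> angle z" if "x \<in> {0..<1}" for x
    proof -
      have "frac x = x" using that frac_eq by auto
      then have "Arg2pi (turn x) = 2 * pi * x" using angle_turn[of x] by (simp add: angle_def field_simps)
      then show ?thesis by (simp add: arc_from_one_def angle_def field_simps)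
    qed
    then have "{x \<in> {0..<1}. turn x \<in> arc_from_one z} = {0..angle z}"
      using angle_bounds[of z] by auto
    then have "measure circle_lebesgue (arc_from_one z) = angle z"
      using measure_circle_lebesgue(2)[OF arc] angle_bounds[of z] by simp
    then show ?thesis using True turn_angle[of z] by (simp add: dist_fun_def turn_def)
  qed (simp add: dist_fun_def)
qed

text \<open>The lift of the identity has all ratios equal to 1, so every modulus serves; the
  hypothesis merely supplies one.\<close>

lemma symmetric_circle_lebesgue:
  assumes \<epsilon>: "symmetry_modulus \<epsilon>"
  shows "symmetric_measure circle_lebesgue"
proof -
  have lift: "is_lift 1 (restrict id circle) (\<lambda>x. x)"
    unfolding is_lift_def by (auto simp: strict_mono_def homeomorphism_def id_def[symmetric])
  moreover have "symmetric_with \<epsilon> (\<lambda>x. x)"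
    using \<epsilon> unfolding symmetry_modulus_def symmetric_with_def by (auto simp: less_imp_le field_simps)
  moreover have "homeomorphism circle circle (restrict id circle) id"
    by (rule homeomorphismI) (auto intro: continuous_on_eq[OF continuous_on_id])
  ultimately have "symmetric_homeo (restrict id circle)"
    unfolding symmetric_homeo_def circle_homeo_def using \<epsilon> by auto
  then show ?thesis
    unfolding symmetric_measure_def circle_prob_def dist_fun_circle_lebesgue
    using prob_space_circle_lebesgue by simp
qed


section \<open>The circle endomorphism of an inverse lift\<close>

context inverse_lift
begin

lemma F_add_int: "F (x + of_int k) = F x + of_int k * real d"
proof -
  have nat: "F (x + real n) = F x + real n * real d" for x n
  proof (induction n)
    case (Suc n)
    then show ?case using F_add_1[of "x + real n"] by (simp add: algebra_simps)
  qed simp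
  show ?thesis
  proof (cases "k \<ge> 0")
    case True
    then show ?thesis using nat[of x "nat k"] by simp
  next
    case False
    then show ?thesis using nat[of "x + of_int k" "nat (- k)"] by simp
  qed
qed

lemma G_add_int_d: "G (x + of_int k * real d) = G x + of_int k"
  using F_add_int[of "G x" k] G_F[of "G x + of_int k"] by simp

definition f :: "complex \<Rightarrow> complex" where
  "f = (\<lambda>z\<in>circle. turn (F (angle z)))"

text \<open>Integer translations of \<open>x\<close> change \<open>F x\<close> by integers, so the
  representative chosen by \<open>angle\<close> is immaterial.\<close>

lemma f_turn: "f (turn x) = turn (F x)"
proof -
  have "F x = F (frac x) + of_int (\<lfloor>x\<rfloor> * int d)"
    using F_add_int[of "frac x" "\<lfloor>x\<rfloor>"] by (simp add: frac_def)
  then show ?thesis by (simp only: turn_add_int) (simp add: f_def angle_turn)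
qed

lemma circle_turn: "z \<in> circle \<Longrightarrow> \<exists>x\<in>{0..<1}. z = turn x"
  using turn_angle[of z] angle_bounds[of z] by (intro bexI[of _ "angle z"]) auto

lemma f_in_circle: "f \<in> circle \<rightarrow> circle"
  by (auto simp: f_def)

lemma is_lift_f: "is_lift d f F"
  unfolding is_lift_def using F_homeomorphism F_strict_mono F_add_1 f_turn by (simp add: turn_def)

text \<open>The coordinate \<open>angle\<close> jumps at 1, so continuity is checked locally: near
  \<open>turn a\<close> the map is \<open>turn\<close> after \<open>F\<close> after
  \<open>turn_branch a\<close>.\<close>

lemma f_continuous: "continuous_on circle f"
  unfolding continuous_on_eq_continuous_within
proof
  fix z assume "z \<in> circle"
  then obtain a where a: "z = turn a" using circle_turn by blast
  define T where "T = turn ` {a - 1 / 2<..<a + 1 / 2}"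
  have "continuous_on T (\<lambda>w. turn (F (turn_branch a w)))"
    using homeomorphism_cont2[OF turn_homeomorphism[of a]] unfolding T_def
    by (intro continuous_on_compose2[OF turn_continuous[of UNIV]] continuous_on_compose2[OF F_continuous[of UNIV]]) auto
  then have "continuous_on T f"
    by (rule continuous_on_eq) (auto simp: T_def f_turn homeomorphism_apply1[OF turn_homeomorphism])
  moreover have zT: "z \<in> T" unfolding T_def a by (rule imageI) simp
  ultimately have cont: "continuous (at z within T) f" by (simp add: continuous_on_eq_continuous_within)
  obtain W where W: "open W" "T = circle \<inter> W"
    using turn_image_unit_open[of a] unfolding T_def openin_open by blast
  have "at z within T = at z within circle"
    by (rule at_within_nhd[of _ W]) (use W zT in auto)
  then show "continuous (at z within circle) f" using cont by simp
qed

section \<open>Evenly covered neighbourhoods\<close>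

text \<open>The \<open>i\<close>-th preimage of the circle punctured at the antipode of
  \<open>turn a\<close>, parametrised by the \<open>i\<close>-th inverse branch.\<close>

definition sheet :: "real \<Rightarrow> nat \<Rightarrow> complex set" where
  "sheet a i = turn ` G ` {a + real i - 1 / 2<..<a + real i + 1 / 2}"

lemma sheet_open: "openin (top_of_set circle) (sheet a i)"
proof -
  let ?J = "{a + real i - 1 / 2<..<a + real i + 1 / 2}"
  \<comment> \<open>The midpoint of the image interval. Its length is below 1 because
    \<open>G\<close> contracts, so it fits into a unit interval, on which \<open>turn\<close> is an
    open map.\<close>
  define c where "c = (G (a + real i - 1 / 2) + G (a + real i + 1 / 2)) / 2"
  have "G (a + real i + 1 / 2) - G (a + real i - 1 / 2) < 1"
    using G_diff_le[of "a + real i - 1 / 2" "a + real i + 1 / 2"] m_pos by simp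
  then have c: "c - 1 / 2 < G (a + real i - 1 / 2)" "G (a + real i + 1 / 2) < c + 1 / 2"
    by (simp_all add: c_def field_simps)
  have sub: "G ` ?J \<subseteq> {c - 1 / 2<..<c + 1 / 2}"
  proof
    fix w assume "w \<in> G ` ?J"
    then obtain x where x: "x \<in> ?J" "w = G x" by blast
    then have "G (a + real i - 1 / 2) < w" "w < G (a + real i + 1 / 2)"
      by (simp_all only: G_less_iff greaterThanLessThan_iff)
    with c show "w \<in> {c - 1 / 2<..<c + 1 / 2}" unfolding greaterThanLessThan_iff by linarith
  qed
  have "G ` ?J = F -` ?J"
  proof (intro set_eqI iffI)
    fix w assume "w \<in> F -` ?J"
    then show "w \<in> G ` ?J" by (intro image_eqI[of w G "F w"]) simp_all
  qed auto
  then have "open (G ` ?J)" using F_continuous[of UNIV] by (simp add: continuous_on_open_vimage)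
  then show ?thesis unfolding sheet_def by (rule turn_image_open[OF _ sub])
qed

text \<open>If \<open>G x\<close> and \<open>G y\<close> differ by an integer \<open>k\<close>, then
  \<open>x\<close> and \<open>y\<close> differ by \<open>k * d\<close>. As \<open>x\<close> and
  \<open>y\<close> are within 1/2 of \<open>a + i\<close> and \<open>a + j\<close>, the integer
  \<open>i - j - k * d\<close> has absolute value below 1, so \<open>i\<close> and \<open>j\<close>
  agree modulo \<open>d\<close>.\<close>

lemma sheet_disjoint:
  assumes "i < d" "j < d" "turn (G x) = turn (G y)"
    and x: "x \<in> {a + real i - 1 / 2<..<a + real i + 1 / 2}"
    and y: "y \<in> {a + real j - 1 / 2<..<a + real j + 1 / 2}"
  shows "i = j"
proof -
  obtain k :: int where "G x = G y + of_int k" using assms(3) turn_eq_iff by blast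
  then have "x = y + of_int k * real d" by (simp flip: G_add_int_d)
  moreover define D where "D = int i - int j - k * int d"
  ultimately have "\<bar>real_of_int D\<bar> < 1" using x y by (auto simp: abs_less_iff)
  then have "D = 0" by simp
  then have eq: "int i = int j + k * int d" by (simp add: D_def)
  then have "int i mod int d = int j mod int d" by simp
  with assms(1,2) show ?thesis by simp
qed

lemma sheet_homeomorphism:
  "homeomorphism (sheet a i) (turn ` {a - 1 / 2<..<a + 1 / 2}) f (\<lambda>w. turn (G (turn_branch a w + real i)))"
proof (rule homeomorphismI)
  have br: "turn_branch a (turn x) = x" if "x \<in> {a - 1 / 2<..<a + 1 / 2}" for x
    by (rule turn_branch_turn) (use that in \<open>auto simp: abs_if\<close>)
  have shift: "\<exists>y\<in>{a - 1 / 2<..<a + 1 / 2}. x = y + real i"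
    if "x \<in> {a + real i - 1 / 2<..<a + real i + 1 / 2}" for x
    using that by (intro bexI[of _ "x - real i"]) auto
  have "sheet a i \<subseteq> circle" by (auto simp: sheet_def)
  then show "continuous_on (sheet a i) f" by (rule continuous_on_subset[OF f_continuous])
  show "continuous_on (turn ` {a - 1 / 2<..<a + 1 / 2}) (\<lambda>w. turn (G (turn_branch a w + real i)))"
    by (intro continuous_on_compose2[OF turn_continuous[of UNIV]] continuous_on_compose2[OF G_continuous[of UNIV]]
        continuous_on_add continuous_on_const homeomorphism_cont2[OF turn_homeomorphism]) auto
  show "f ` sheet a i \<subseteq> turn ` {a - 1 / 2<..<a + 1 / 2}"
    unfolding sheet_def using shift by (force simp: f_turn)
  show "(\<lambda>w. turn (G (turn_branch a w + real i))) ` turn ` {a - 1 / 2<..<a + 1 / 2} \<subseteq> sheet a i"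
    unfolding sheet_def by (force simp: br)
  show "turn (G (turn_branch a (f z) + real i)) = z" if "z \<in> sheet a i" for z
    using that shift br unfolding sheet_def by (force simp: f_turn)
  show "f (turn (G (turn_branch a w + real i))) = w" if "w \<in> turn ` {a - 1 / 2<..<a + 1 / 2}" for w
    using that br by (auto simp: f_turn)
qed

lemma sheets_cover:
  "\<Union> (sheet a ` {..<d}) = circle \<inter> f -` turn ` {a - 1 / 2<..<a + 1 / 2}"
proof (intro set_eqI iffI)
  fix z assume "z \<in> \<Union> (sheet a ` {..<d})"
  then obtain i where "z \<in> sheet a i" by blast
  then show "z \<in> circle \<inter> f -` turn ` {a - 1 / 2<..<a + 1 / 2}"
    using homeomorphism_image1[OF sheet_homeomorphism, of a i] by (auto simp: sheet_def)
next
  fix z assume z: "z \<in> circle \<inter> f -` turn ` {a - 1 / 2<..<a + 1 / 2}"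
  then obtain y where y: "z = turn y" using circle_turn by blast
  with z obtain x where x: "x \<in> {a - 1 / 2<..<a + 1 / 2}" "turn (F y) = turn x" by (auto simp: f_turn)
  then obtain n :: int where n: "F y = x + of_int n" using turn_eq_iff by blast
  \<comment> \<open>Division of \<open>n\<close> by \<open>d\<close>: the remainder selects the
    sheet, and the quotient becomes an integer translation under \<open>G\<close>, which
    \<open>turn\<close> does not see.\<close>
  define i where "i = nat (n mod int d)"
  define k where "k = n div int d"
  have i: "i < d" "n = k * int d + int i" using d_ge by (auto simp: i_def k_def nat_less_iff)
  have "F y = (x + real i) + of_int k * real d" using n i(2) by simp
  then have "y = G ((x + real i) + of_int k * real d)" by (metis G_F F_G)
  then have "y = G (x + real i) + of_int k" by (simp only: G_add_int_d)
  then have "z = turn (G (x + real i))" using y by simp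
  moreover have "x + real i \<in> {a + real i - 1 / 2<..<a + real i + 1 / 2}" using x(1) by simp
  ultimately have "z \<in> sheet a i" unfolding sheet_def by blast
  then show "z \<in> \<Union> (sheet a ` {..<d})" using i(1) by blast
qed

lemma f_covering: "covering_space circle f circle"
proof
  show "continuous_on circle f" by (rule f_continuous)
  show "f ` circle = circle"
  proof
    show "f ` circle \<subseteq> circle" using f_in_circle by blast
    show "circle \<subseteq> f ` circle"
    proof
      fix z assume "z \<in> circle"
      then obtain x where "z = turn x" using circle_turn by blast
      then have "z = f (turn (G x))" by (simp add: f_turn)
      then show "z \<in> f ` circle" by (intro image_eqI) auto
    qed
  qed
  fix z assume "z \<in> circle"
  then obtain a where a: "z = turn a" using circle_turn by blast
  define T where "T = turn ` {a - 1 / 2<..<a + 1 / 2}"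
  show "\<exists>T. z \<in> T \<and> openin (top_of_set circle) T \<and>
    (\<exists>v. \<Union> v = circle \<inter> f -` T \<and> (\<forall>u\<in>v. openin (top_of_set circle) u) \<and>
         pairwise disjnt v \<and> (\<forall>u\<in>v. \<exists>q. homeomorphism u T f q))"
  proof (intro exI[of _ T] exI[of _ "sheet a ` {..<d}"] conjI ballI)
    show "z \<in> T" unfolding T_def a by (rule imageI) simp
    show "openin (top_of_set circle) T" unfolding T_def by (rule turn_image_unit_open)
    show "\<Union> (sheet a ` {..<d}) = circle \<inter> f -` T" unfolding T_def by (rule sheets_cover)
    show "openin (top_of_set circle) u" if "u \<in> sheet a ` {..<d}" for u
      using that sheet_open by blast
    show "\<exists>q. homeomorphism u T f q" if "u \<in> sheet a ` {..<d}" for u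
      using that sheet_homeomorphism unfolding T_def by blast
    show "pairwise disjnt (sheet a ` {..<d})"
    proof (rule pairwiseI)
      fix u v assume uv: "u \<in> sheet a ` {..<d}" "v \<in> sheet a ` {..<d}" "u \<noteq> v"
      then obtain i j where ij: "i < d" "j < d" "u = sheet a i" "v = sheet a j" by blast
      with uv have "i \<noteq> j" by blast
      show "disjnt u v"
      proof (rule ccontr)
        assume "\<not> disjnt u v"
        then obtain z where z: "z \<in> sheet a i" "z \<in> sheet a j" unfolding ij disjnt_iff by blast
        from z(1) obtain x where x: "x \<in> {a + real i - 1 / 2<..<a + real i + 1 / 2}" "z = turn (G x)"
          unfolding sheet_def by blast
        from z(2) obtain y where y: "y \<in> {a + real j - 1 / 2<..<a + real j + 1 / 2}" "z = turn (G y)"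
          unfolding sheet_def by blast
        have "i = j" by (rule sheet_disjoint[OF ij(1,2) _ x(1) y(1)]) (use x y in simp)
        with \<open>i \<noteq> j\<close> show False ..
      qed
    qed
  qed
qed

lemma f_in_US: "f \<in> US d"
proof -
  have "f 1 = 1" using f_turn[of 0] by simp
  then have "circle_endomorphism d f"
    unfolding circle_endomorphism_def using f_covering is_lift_f by (auto simp: f_def)
  moreover have "uniformly_symmetric d f"
    unfolding uniformly_symmetric_def inv_F
    using is_lift_f symmetry_modulus_modulus symmetric_with_iter inv_F by force
  ultimately show ?thesis by (simp add: US_def)
qed

section \<open>Invariance of Lebesgue measure\<close>

text \<open>The circle map in the coordinate \<open>[0, 1)\<close>, which moves the invariance
  question to the real line.\<close>

definition step :: "real \<Rightarrow> real" where "step x = frac (F x)"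

lemma step_range: "step x \<in> {0..<1}"
  by (simp add: step_def frac_lt_1)

lemma turn_step: "turn (step x) = f (turn x)"
  by (simp add: step_def f_turn)

lemma F_unit:
  assumes "x \<in> {0..<1}"
  shows "0 \<le> F x" "F x < real d"
  using assms strict_mono_less_eq[OF F_strict_mono, of 0 x] strict_mono_less[OF F_strict_mono, of x 1]
    F_add_1[of 0] by auto

lemma step_sublevel:
  assumes y: "0 \<le> y" "y < 1"
  shows "{0..<1} \<inter> {x. step x \<le> y} = (\<Union>i<d. {G (real i)..G (real i + y)})"
proof (intro set_eqI iffI)
  fix x assume x: "x \<in> {0..<1} \<inter> {x. step x \<le> y}"
  \<comment> \<open>The integer part of \<open>F x\<close> is the number of the branch that leads
    back to \<open>x\<close>.\<close>
  define i where "i = nat \<lfloor>F x\<rfloor>"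
  have "0 \<le> \<lfloor>F x\<rfloor>" using F_unit(1)[of x] x by simp
  then have Fx: "F x = real i + step x" by (simp add: i_def step_def frac_def)
  have "real i < real d" using F_unit(2)[of x] x step_range[of x] Fx by auto
  then have "i < d" by simp
  moreover have "x = G (real i + step x)" using F_G G_F Fx by metis
  then have "x \<in> {G (real i)..G (real i + y)}"
    using x step_range[of x] by (metis G_le_iff Int_iff add_le_cancel_left atLeastAtMost_iff
        atLeastLessThan_iff le_add_same_cancel1 mem_Collect_eq)
  ultimately show "x \<in> (\<Union>i<d. {G (real i)..G (real i + y)})" by blast
next
  fix x assume "x \<in> (\<Union>i<d. {G (real i)..G (real i + y)})"
  then obtain i where i: "i < d" "G (real i) \<le> x" "x \<le> G (real i + y)" by auto
  then have Fx: "real i \<le> F x" "F x \<le> real i + y"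
    by (metis G_F G_le_iff)+
  then have "\<lfloor>F x\<rfloor> = int i" using y by (simp add: floor_eq_iff)
  then have "step x \<le> y" using Fx by (simp add: step_def frac_def)
  moreover have "0 \<le> x" using i(2) G_le_iff[of 0 "real i"] by simp
  moreover have "x < G (real d)"
  proof -
    have "real i + y < real d" using i(1) y by linarith
    then show ?thesis using i(3) by (metis G_less_iff order_le_less_trans)
  qed
  ultimately show "x \<in> {0..<1} \<inter> {x. step x \<le> y}" by (simp add: G_d)
qed

lemma step_measurable [measurable]: "step \<in> borel_measurable borel"
proof -
  have [measurable]: "F \<in> borel_measurable borel"
    by (rule borel_measurable_continuous_onI[OF F_continuous])
  show ?thesis unfolding step_def frac_def by measurable
qed

text \<open>The sublevel set consists of one interval per branch, disjoint because
  \<open>y < 1\<close>, and \<open>G_branch_sum\<close> adds up their lengths. This is where the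
  normalisation of \<open>p\<close> becomes invariance.\<close>

lemma measure_step_sublevel:
  assumes y: "0 \<le> y" "y < 1"
  shows "measure lborel ({0..<1} \<inter> {x. step x \<le> y}) = y"
proof -
  have dis: "disjoint_family_on (\<lambda>i. {G (real i)..G (real i + y)}) {..<d}"
  proof -
    have less: "G (real i + y) < G (real j)" if "i < j" for i j :: nat
    proof -
      have "real i + 1 \<le> real j" using that by simp
      then show ?thesis using y by (simp only: G_less_iff)
    qed
    show ?thesis
      unfolding disjoint_family_on_def
    proof (intro ballI impI)
      fix i j :: nat assume "i \<noteq> j"
      then consider "i < j" | "j < i" by linarith
      then show "{G (real i)..G (real i + y)} \<inter> {G (real j)..G (real j + y)} = {}"
        by cases (use less in \<open>force simp del: G_less_iff G_le_iff\<close>)+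
    qed
  qed
  have "measure lborel (\<Union>i<d. {G (real i)..G (real i + y)}) =
      (\<Sum>i<d. measure lborel {G (real i)..G (real i + y)})"
    by (rule measure_finite_Union) (use dis y in auto)
  also have "\<dots> = (\<Sum>i<d. G (y + real i) - G (real i))"
    using y by (intro sum.cong) (auto simp: add.commute)
  also have "\<dots> = y" by (rule G_branch_sum)
  finally show ?thesis by (simp add: step_sublevel[OF y])
qed

text \<open>Both measures are probability measures on the line, so equality of their distribution
  functions suffices.\<close>

lemma distr_step: "distr turn_measure borel step = turn_measure"
proof (rule cdf_unique)
  interpret prob_space turn_measure by (rule prob_space_turn_measure)
  show "real_distribution (distr turn_measure borel step)"
    by (rule real_distribution_distr) simp
  show "real_distribution turn_measure"
    by (simp add: real_distribution_def real_distribution_axioms_def prob_space_turn_measure)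
  show "cdf (distr turn_measure borel step) = cdf turn_measure"
  proof
    fix y :: real
    have meas: "{x. step x \<le> y} \<in> sets borel" by simp
    have "cdf (distr turn_measure borel step) y = measure lborel ({0..<1} \<inter> {x. step x \<le> y})"
      unfolding cdf_def2 by (subst measure_distr) (auto simp: vimage_def measure_turn_measure[OF meas])
    also have "\<dots> = measure lborel ({0..<1} \<inter> {..y})"
    proof -
      consider "y < 0" | "1 \<le> y" | "0 \<le> y" "y < 1" by linarith
      then show ?thesis
      proof cases
        case 1
        have "\<not> step x \<le> y" for x using step_range[of x] 1 by simp
        then have "{0..<1} \<inter> {x. step x \<le> y} = {}" by simp
        moreover have "{0..<1} \<inter> {..y} = {}" using 1 by auto
        ultimately show ?thesis by simp
      next
        case 2
        have "step x \<le> y" for x using step_range[of x] 2 by simp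
        then have "{0..<1} \<inter> {x. step x \<le> y} = {0..<1}" by simp
        moreover have "{0..<1} \<inter> {..y} = {0..<1}" using 2 by auto
        ultimately show ?thesis by simp
      next
        case 3
        then have "{0..<1} \<inter> {..y} = {0..y}" by auto
        then show ?thesis using measure_step_sublevel[OF 3] 3 by simp
      qed
    qed
    also have "\<dots> = cdf turn_measure y" unfolding cdf_def2 by (simp add: measure_turn_measure)
    finally show "cdf (distr turn_measure borel step) y = cdf turn_measure y" .
  qed
qed

lemma f_measurable: "f \<in> measurable (restrict_space borel circle) (restrict_space borel circle)"
  by (intro measurable_restrict_space2 borel_measurable_continuous_on_restrict f_continuous)
    (use f_in_circle in \<open>auto simp: space_restrict_space\<close>)

lemma distr_f: "distr circle_lebesgue circle_lebesgue f = circle_lebesgue"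
proof -
  let ?R = "restrict_space borel circle"
  have "distr circle_lebesgue circle_lebesgue f = distr (distr turn_measure ?R turn) ?R f"
    by (rule distr_cong) (auto simp: circle_lebesgue_def)
  also have "\<dots> = distr turn_measure ?R (f \<circ> turn)"
    by (rule distr_distr[OF f_measurable turn_measurable])
  also have "f \<circ> turn = turn \<circ> step" by (auto simp: turn_step)
  also have "distr turn_measure ?R (turn \<circ> step) = distr (distr turn_measure borel step) ?R turn"
    by (rule distr_distr[symmetric])
      (use turn_measurable in \<open>simp_all add: measurable_cong_sets[OF sets_turn_measure refl]\<close>)
  also have "\<dots> = circle_lebesgue" unfolding distr_step circle_lebesgue_def ..
  finally show ?thesis .
qed

lemma f_measurable_lebesgue: "f \<in> measurable circle_lebesgue circle_lebesgue"
  using f_measurable by (simp add: measurable_cong_sets[OF sets_circle_lebesgue sets_circle_lebesgue])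

sublocale sys: measure_preserving circle_lebesgue f
  using prob_space_circle_lebesgue f_measurable_lebesgue distr_f
  by (simp add: measure_preserving_def measure_preserving_axioms_def)

lemma invariant_f: "invariant_measure circle_lebesgue f"
  unfolding invariant_measure_def using f_measurable_lebesgue distr_f by simp

section \<open>The generating partition into branch intervals\<close>

definition sheet_index :: "complex \<Rightarrow> nat" where
  "sheet_index z = nat \<lfloor>F (angle z)\<rfloor>"

lemma sheet_index_turn:
  assumes "x \<in> {0..<1}"
  shows "sheet_index (turn x) = nat \<lfloor>F x\<rfloor>"
proof -
  have "frac x = x" using assms by (auto simp: frac_eq)
  then show ?thesis by (simp add: sheet_index_def angle_turn)
qed

lemma F_eq_index_add_step:
  assumes "x \<in> {0..<1}"
  shows "F x = real (sheet_index (turn x)) + step x"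
  unfolding sheet_index_turn[OF assms] step_def frac_def using F_unit(1)[OF assms] by simp

lemma sheet_index_less: "sheet_index z < d"
proof -
  have "F (angle z) < real d" "0 \<le> F (angle z)"
    using F_unit[of "angle z"] angle_bounds[of z] by auto
  then show ?thesis unfolding sheet_index_def by linarith
qed

lemma simple_function_sheet_index: "simple_function circle_lebesgue sheet_index"
  unfolding simple_function_def
proof (intro conjI ballI)
  have "sheet_index ` space circle_lebesgue \<subseteq> {..<d}" using sheet_index_less by auto
  then show "finite (sheet_index ` space circle_lebesgue)" by (rule finite_subset) simp
  fix i
  have [measurable]: "F \<in> borel_measurable borel"
    by (rule borel_measurable_continuous_onI[OF F_continuous])
  have [measurable]: "Arg2pi \<in> borel_measurable borel"
    unfolding borel_measurable_iff_le using closed_Arg2pi2pi_le by simp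
  have [measurable]: "angle \<in> borel_measurable borel"
    unfolding angle_def by measurable
  have "sheet_index \<in> measurable borel (count_space UNIV)"
    unfolding sheet_index_def by measurable
  then have "sheet_index -` {i} \<inter> space borel \<in> sets borel" by (rule measurable_sets) simp
  then have "circle \<inter> sheet_index -` {i} \<in> sets (restrict_space borel circle)"
    by (subst sets_restrict_space) auto
  then show "sheet_index -` {i} \<inter> space circle_lebesgue \<in> sets circle_lebesgue"
    by (simp add: Int_commute)
qed

lemma itin_Suc: "sys.itin c (Suc n) z = c z # sys.itin c n (f z)"
  using sys.itin_add[of c 1 n z] by (simp add: sys.itin_def)

text \<open>Equal symbols mean that both points are recovered from their images by the same inverse
  branch, which contracts by \<open>1 - m\<close>. The induction starts from two points of
  \<open>[0, 1)\<close>, at distance below 1.\<close>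

lemma close_of_same_itin:
  assumes "x \<in> {0..<1}" "y \<in> {0..<1}"
    and "sys.itin sheet_index n (turn x) = sys.itin sheet_index n (turn y)"
  shows "\<bar>x - y\<bar> \<le> (1 - m) ^ n"
  using assms
proof (induction n arbitrary: x y)
  case (Suc n)
  have index: "sheet_index (turn x) = sheet_index (turn y)"
    and "sys.itin sheet_index n (turn (step x)) = sys.itin sheet_index n (turn (step y))"
    using Suc.prems(3) by (simp_all add: itin_Suc turn_step)
  then have IH: "\<bar>step x - step y\<bar> \<le> (1 - m) ^ n" by (intro Suc.IH step_range)
  have "\<bar>G u - G v\<bar> \<le> (1 - m) * \<bar>u - v\<bar>" for u v
    using G_diff_le[of u v] G_diff_le[of v u] by (cases "u \<le> v") (simp_all add: abs_if)
  from this[of "F x" "F y"] have "\<bar>x - y\<bar> \<le> (1 - m) * \<bar>F x - F y\<bar>" by simp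
  also have "\<dots> = (1 - m) * \<bar>step x - step y\<bar>"
    using F_eq_index_add_step[OF Suc.prems(1)] F_eq_index_add_step[OF Suc.prems(2)] index by simp
  also have "\<dots> \<le> (1 - m) * (1 - m) ^ n" using IH m_less by (intro mult_left_mono) auto
  finally show ?case by simp
qed (auto simp: abs_if)

text \<open>Inner regularity replaces the cells by finitely many disjoint compact sets; these have
  positive distance, so long itineraries tell them apart.\<close>

lemma sheet_index_generates:
  assumes P: "finite_partition circle_lebesgue P" and \<delta>: "\<delta> > 0"
  shows "\<exists>n g. sys.prob {z \<in> space circle_lebesgue. sys.cell P z \<noteq> g (sys.itin sheet_index n z)} \<le> \<delta>"
proof -
  have fin: "finite P" and sub: "P \<subseteq> sets circle_lebesgue" and part: "partition_on circle P"
    using P by (auto simp: finite_partition_def)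
  interpret T: prob_space turn_measure by (rule prob_space_turn_measure)
  define B where "B A = {0..<1} \<inter> turn -` A" for A
  \<comment> \<open>The share of the error \<delta> allotted to each cell; the \<open>+ 1\<close>
    keeps the denominator positive.\<close>
  define \<eta> where "\<eta> = \<delta> / real (card P + 1)"
  have \<eta>: "\<eta> > 0" using \<delta> by (simp add: \<eta>_def)
  have B: "B A \<in> sets borel" if "A \<in> P" for A
    using measure_circle_lebesgue(1)[of A] sub that by (auto simp: B_def)
  have "\<exists>K. compact K \<and> K \<subseteq> B A \<and> T.prob (B A - K) \<le> \<eta>" if "A \<in> P" for A
  proof -
    have SUP: "emeasure turn_measure (B A) = (SUP K \<in> {K. K \<subseteq> B A \<and> compact K}. emeasure turn_measure K)"
      by (rule inner_regular) (use B[OF that] T.emeasure_finite in auto)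
    show ?thesis
    proof (cases "T.prob (B A) \<le> \<eta>")
      case True
      then show ?thesis by (intro exI[of _ "{}"]) simp
    next
      case False
      then have "ennreal (T.prob (B A) - \<eta>) < emeasure turn_measure (B A)"
        using \<eta> by (simp add: T.emeasure_eq_measure ennreal_lessI)
      then obtain K where K: "K \<subseteq> B A" "compact K" "ennreal (T.prob (B A) - \<eta>) < emeasure turn_measure K"
        unfolding SUP less_SUP_iff by blast
      have "T.prob (B A) - \<eta> < T.prob K"
        using K(3) False by (simp add: T.emeasure_eq_measure ennreal_less_iff)
      moreover have "T.prob (B A - K) = T.prob (B A) - T.prob K"
        by (rule T.finite_measure_Diff) (use B[OF that] K in \<open>auto intro: borel_compact\<close>)
      ultimately show ?thesis using K by (intro exI[of _ K]) simp
    qed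
  qed
  then obtain K where K: "\<And>A. A \<in> P \<Longrightarrow> compact (K A)" "\<And>A. A \<in> P \<Longrightarrow> K A \<subseteq> B A"
    "\<And>A. A \<in> P \<Longrightarrow> T.prob (B A - K A) \<le> \<eta>" by metis
  have "\<forall>\<^sub>F r in at_right 0. \<forall>x\<in>K A. \<forall>y\<in>K A'. r \<le> dist x y"
    if AA: "A \<in> P" "A' \<in> P" "A \<noteq> A'" for A A'
  proof -
    have "A \<inter> A' = {}" using disjointD[OF partition_onD2[OF part]] AA by blast
    then have "K A \<inter> K A' = {}" using K(2)[OF AA(1)] K(2)[OF AA(2)] by (auto simp: B_def)
    then obtain r where r: "r > 0" "\<forall>x\<in>K A. \<forall>y\<in>K A'. r \<le> dist x y"
      using separate_compact_closed[OF K(1)[OF AA(1)] compact_imp_closed[OF K(1)[OF AA(2)]]] by blast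
    then show ?thesis
      unfolding eventually_at_right_field by (intro exI[of _ r]) (auto intro: order_trans[OF less_imp_le])
  qed
  then have "\<forall>\<^sub>F r in at_right (0::real). \<forall>A\<in>P. \<forall>A'\<in>P. A \<noteq> A' \<longrightarrow> (\<forall>x\<in>K A. \<forall>y\<in>K A'. r \<le> dist x y)"
    by (intro eventually_ball_finite fin ballI) (auto intro: eventually_mono)
  then obtain b where b: "b > 0" and
    b2: "\<And>r. r > 0 \<Longrightarrow> r < b \<Longrightarrow> \<forall>A\<in>P. \<forall>A'\<in>P. A \<noteq> A' \<longrightarrow> (\<forall>x\<in>K A. \<forall>y\<in>K A'. r \<le> dist x y)"
    unfolding eventually_at_right_field by blast
  \<comment> \<open>The filter yields the separation only for \<open>r < b\<close>, hence the
    half.\<close>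
  have sep: "b / 2 \<le> dist x y" if "A \<in> P" "A' \<in> P" "A \<noteq> A'" "x \<in> K A" "y \<in> K A'" for A A' x y
  proof -
    have "0 < b / 2" "b / 2 < b" using b by auto
    from b2[OF this] that show ?thesis by blast
  qed
  obtain n where n: "(1 - m) ^ n < b / 2"
    using real_arch_pow_inv[of "b / 2" "1 - m"] b m_pos by auto
  define I where "I x = sys.itin sheet_index n (turn x)" for x
  \<comment> \<open>Predict a cell whose compact part contains a point with this itinerary. By the
    choice of \<open>n\<close> there is at most one such cell; if there is none, the value is
    arbitrary.\<close>
  define g where "g l = (SOME A. A \<in> P \<and> (\<exists>x\<in>K A. I x = l))" for l
  have gI: "g (I x) = A" if "A \<in> P" "x \<in> K A" for A x
  proof -
    have "g (I x) \<in> P \<and> (\<exists>y\<in>K (g (I x)). I y = I x)"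
      unfolding g_def by (rule someI[of _ A]) (use that in blast)
    then obtain y where y: "g (I x) \<in> P" "y \<in> K (g (I x))" "I y = I x" by blast
    have "x \<in> {0..<1}" "y \<in> {0..<1}" using K(2)[OF that(1)] K(2)[OF y(1)] that(2) y(2) by (auto simp: B_def)
    then have "\<bar>x - y\<bar> \<le> (1 - m) ^ n" using y(3) by (intro close_of_same_itin) (auto simp: I_def)
    with n have "dist x y < b / 2" by (simp add: dist_real_def)
    then show ?thesis using sep[OF that(1) y(1) _ that(2) y(2)] by fastforce
  qed
  define E where "E = {z \<in> circle. sys.cell P z \<noteq> g (sys.itin sheet_index n z)}"
  have E: "E \<in> sets circle_lebesgue"
  proof -
    have "simple_function circle_lebesgue (\<lambda>z. sys.cell P z = g (sys.itin sheet_index n z))"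
      using simple_function_compose2[OF sys.simple_function_cell[OF P]
          sys.simple_function_itin[OF simple_function_sheet_index, of n], of "\<lambda>A l. A = g l"] .
    from simple_functionD(2)[OF this, of "{False}"]
    have "(\<lambda>z. sys.cell P z = g (sys.itin sheet_index n z)) -` {False} \<inter> circle \<in> sets circle_lebesgue"
      by simp
    moreover have "(\<lambda>z. sys.cell P z = g (sys.itin sheet_index n z)) -` {False} \<inter> circle = E"
      by (auto simp: E_def)
    ultimately show ?thesis by simp
  qed
  \<comment> \<open>On the compact parts the prediction is correct by \<open>gI\<close>, so errors
    occur only in the small remainders.\<close>
  have "{x \<in> {0..<1}. turn x \<in> E} \<subseteq> {0..<1} \<inter> (\<Union>A\<in>P. B A - K A)"
  proof
    fix x assume x: "x \<in> {x \<in> {0..<1}. turn x \<in> E}"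
    define A where "A = sys.cell P (turn x)"
    have A: "A \<in> P" "turn x \<in> A"
      using sys.cell_in[of P "turn x"] sys.cell_eq_iff[of P "turn x" A] part by (auto simp: A_def)
    moreover have "x \<notin> K A" using x gI[OF A(1)] by (auto simp: E_def I_def A_def)
    ultimately show "x \<in> {0..<1} \<inter> (\<Union>A\<in>P. B A - K A)" using x by (auto simp: B_def)
  qed
  moreover have meas: "B A - K A \<in> sets borel" if "A \<in> P" for A
    using B[OF that] K(1)[OF that] by (intro sets.Diff) (auto intro: borel_compact)
  ultimately have sub': "{x \<in> {0..<1}. turn x \<in> E} \<subseteq> (\<Union>A\<in>P. B A - K A)"
    and U: "(\<Union>A\<in>P. B A - K A) \<in> sets borel"
    using fin by (auto intro!: sets.finite_UN)
  have "{x \<in> {0..<1}. turn x \<in> E} = {0..<1} \<inter> turn -` E" by auto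
  then have "{x \<in> {0..<1}. turn x \<in> E} \<in> sets borel"
    using measure_circle_lebesgue(1)[OF E] by simp
  then have "measure circle_lebesgue E = T.prob {x \<in> {0..<1}. turn x \<in> E}"
    unfolding measure_circle_lebesgue(2)[OF E]
    by (subst measure_turn_measure) (auto intro!: arg_cong[where f = "measure lborel"])
  also have "\<dots> \<le> T.prob (\<Union>A\<in>P. B A - K A)"
    using sub' U by (intro T.finite_measure_mono) auto
  also have "\<dots> \<le> (\<Sum>A\<in>P. T.prob (B A - K A))"
    using fin meas by (intro T.finite_measure_subadditive_finite) auto
  also have "\<dots> \<le> (\<Sum>A\<in>P. \<eta>)" by (intro sum_mono K(3))
  also have "\<dots> \<le> \<delta>" using \<delta> by (simp add: \<eta>_def field_simps)
  finally show ?thesis unfolding E_def by auto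
qed

lemma G_1_le: "G 1 \<le> 1"
  using G_le_iff[of 1 "real d"] d_ge by (simp add: G_d)

text \<open>Symbol 0 is seen exactly on \<open>[0, G 1)\<close>, so it dominates the generator with
  error probability \<open>1 - G 1\<close>.\<close>

lemma metric_entropy_f_le: "metric_entropy circle_lebesgue f \<le> ereal (2 * real d * sqrt (1 - G 1))"
proof (rule order_trans[OF sys.metric_entropy_le_generator[OF simple_function_sheet_index sheet_index_generates]])
  let ?E = "{z \<in> space circle_lebesgue. sheet_index z \<noteq> 0}"
  have "{x \<in> {0..<1}. turn x \<in> ?E} = {G 1..<1}"
  proof (intro set_eqI)
    fix x
    have "nat \<lfloor>F x\<rfloor> \<noteq> 0 \<longleftrightarrow> G 1 \<le> x"
      using G_le_iff[of 1 "F x"] by (simp add: le_floor_iff not_less)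
    moreover have "0 \<le> G 1" using G_le_iff[of 0 1] by simp
    ultimately show "x \<in> {x \<in> {0..<1}. turn x \<in> ?E} \<longleftrightarrow> x \<in> {G 1..<1}"
      using sheet_index_turn[of x] by auto
  qed
  moreover have "?E \<in> sets circle_lebesgue"
  proof -
    have "?E = sheet_index -` (- {0}) \<inter> space circle_lebesgue" by auto
    then show ?thesis using simple_functionD(2)[OF simple_function_sheet_index, of "- {0}"] by simp
  qed
  ultimately have "sys.prob ?E \<le> 1 - G 1"
    using measure_circle_lebesgue(2)[of ?E] G_1_le by simp
  then show "ereal (sys.entropy_Pow sheet_index) \<le> ereal (2 * real d * sqrt (1 - G 1))"
    unfolding ereal_less_eq
    by (intro sys.entropy_le_of_dominant_value[OF simple_function_sheet_index, of "{..<d}" d 0])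
      (use sheet_index_less d_ge in auto)
qed

end


section \<open>Inverse lifts with one dominant branch\<close>

lemma abs_cos_diff_le: "\<bar>cos x - cos y\<bar> \<le> \<bar>x - y\<bar>" for x y :: real
proof -
  have *: "\<bar>cos b - cos a\<bar> \<le> b - a" if ab: "a < b" for a b :: real
  proof -
    obtain z where "cos b - cos a = (b - a) * - sin z"
      using MVT2[OF ab, of cos "\<lambda>x. - sin x"] by (auto intro: DERIV_cos)
    then have "\<bar>cos b - cos a\<bar> = (b - a) * \<bar>sin z\<bar>" using that by (simp add: abs_mult)
    also have "\<dots> \<le> (b - a) * 1" using that by (intro mult_left_mono) auto
    finally show ?thesis by simp
  qed
  show ?thesis using *[of x y] *[of y x] by (cases x y rule: linorder_cases) (auto simp: abs_minus_commute)
qed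

locale softmax =
  fixes d :: nat and N :: real
  assumes d_ge: "d \<ge> 2" and N_pos: "N > 0"
begin

text \<open>A wave of period \<open>d\<close> with its peak at 1/2, the centre of the interval meant
  to dominate.\<close>

definition c :: "real \<Rightarrow> real" where "c x = cos (2 * pi * (x - 1 / 2) / real d)"

definition u :: "real \<Rightarrow> real" where "u x = exp (N * c x)"

definition S :: "real \<Rightarrow> real" where "S x = (\<Sum>i<d. u (x + real i))"

definition p :: "real \<Rightarrow> real" where "p x = u x / S x"

text \<open>A Lipschitz constant of \<open>N * c\<close>, the logarithm of \<open>u\<close>.\<close>

definition K :: real where "K = N * (2 * pi / real d)"

lemma u_pos: "0 < u x"
  by (simp add: u_def)

lemma S_pos: "0 < S x"
  unfolding S_def using d_ge u_pos by (intro sum_pos) (auto simp: lessThan_empty_iff)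

lemma c_periodic: "c (x + real d) = c x"
proof -
  have "2 * pi * (x + real d - 1 / 2) / real d = 2 * pi * (x - 1 / 2) / real d + 2 * pi"
    using d_ge by (simp add: field_simps)
  then show ?thesis by (simp add: c_def)
qed

text \<open>A unit shift permutes the summands cyclically, because \<open>u\<close> has period
  \<open>d\<close>. All \<open>d\<close> weights in \<open>p_sum\<close> therefore share one
  denominator.\<close>

lemma S_add_nat: "S (x + real j) = S x"
proof (induction j)
  case (Suc j)
  let ?f = "\<lambda>i. u (x + real j + real i)"
  have "S (x + real (Suc j)) = (\<Sum>i<d. ?f (Suc i))"
    by (simp add: S_def add_ac)
  moreover have "?f 0 + (\<Sum>i<d. ?f (Suc i)) = (\<Sum>i<d. ?f i) + ?f d"
    using sum.lessThan_Suc_shift[of ?f d] by simp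
  moreover have "?f d = ?f 0" by (simp add: u_def c_periodic)
  ultimately show ?case using Suc by (simp add: S_def)
qed simp

lemma p_sum: "(\<Sum>i<d. p (x + real i)) = 1"
  using S_pos[of x] by (simp add: p_def S_add_nat flip: sum_divide_distrib S_def)

lemma u_distortion: "u x \<le> exp (K * \<bar>x - y\<bar>) * u y"
proof -
  have "c x - c y \<le> \<bar>2 * pi * (x - 1 / 2) / real d - 2 * pi * (y - 1 / 2) / real d\<bar>"
    using abs_cos_diff_le unfolding c_def by (meson abs_ge_self order_trans)
  also have "2 * pi * (x - 1 / 2) / real d - 2 * pi * (y - 1 / 2) / real d = 2 * pi / real d * (x - y)"
    by (simp add: diff_divide_distrib algebra_simps)
  also have "\<bar>\<dots>\<bar> = 2 * pi / real d * \<bar>x - y\<bar>" by (simp add: abs_mult)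
  finally have "N * (c x - c y) \<le> N * (2 * pi / real d * \<bar>x - y\<bar>)"
    using N_pos by (intro mult_left_mono) auto
  also have "\<dots> = K * \<bar>x - y\<bar>" by (simp add: K_def)
  finally have "N * (c x - c y) \<le> K * \<bar>x - y\<bar>" .
  then have "N * c x \<le> K * \<bar>x - y\<bar> + N * c y" by (simp add: algebra_simps)
  then show ?thesis by (simp add: u_def flip: exp_add)
qed

lemma S_distortion: "S x \<le> exp (K * \<bar>x - y\<bar>) * S y"
  unfolding S_def sum_distrib_left
proof (rule sum_mono)
  fix i
  show "u (x + real i) \<le> exp (K * \<bar>x - y\<bar>) * u (y + real i)"
    using u_distortion[of "x + real i" "y + real i"] by simp
qed

text \<open>Numerator and denominator contribute a factor \<open>exp (K * \<bar>x - y\<bar>)\<close>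
  each.\<close>

lemma p_distortion: "p x \<le> exp (2 * K * \<bar>x - y\<bar>) * p y"
proof -
  let ?e = "exp (K * \<bar>x - y\<bar>)"
  have Sy: "S y \<le> ?e * S x" using S_distortion[of y x] by (simp add: abs_minus_commute)
  have "p x \<le> ?e * u y / S x"
    unfolding p_def using u_distortion[of x y] S_pos[of x] by (intro divide_right_mono) auto
  also have "\<dots> = ?e * u y * ?e / (?e * S x)" by simp
  also have "\<dots> \<le> ?e * u y * ?e / S y"
    using Sy S_pos u_pos[of y] by (intro divide_left_mono mult_pos_pos) auto
  also have "\<dots> = exp (2 * K * \<bar>x - y\<bar>) * p y"
    using exp_add[of "K * \<bar>x - y\<bar>" "K * \<bar>x - y\<bar>"] by (simp add: p_def mult.assoc)
  finally show ?thesis .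
qed

lemma p_ge: "exp (- 2 * N) / real d \<le> p x"
proof -
  have c: "-1 \<le> c y" "c y \<le> 1" for y by (simp_all add: c_def)
  have "S x \<le> (\<Sum>i<d. exp N)"
    unfolding S_def u_def using c N_pos by (intro sum_mono) simp
  then have S: "S x \<le> real d * exp N" by simp
  have "- N \<le> N * c x" using mult_left_mono[OF c(1), of N x] N_pos by simp
  then have "exp (- N) \<le> u x" by (simp add: u_def)
  then have "exp (- N) / (real d * exp N) \<le> u x / S x"
    using S S_pos[of x] u_pos[of x] by (intro frac_le) auto
  moreover have "exp (- N) / (real d * exp N) = exp (- 2 * N) / real d"
    by (simp add: exp_minus field_simps flip: exp_add)
  ultimately show ?thesis by (simp add: p_def)
qed

lemma p_continuous: "isCont p x"
proof -
  have "isCont u y" for y unfolding u_def c_def using d_ge by (intro continuous_intros) auto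
  moreover have "isCont (\<lambda>x. u (x + real i)) x" for i
    unfolding u_def c_def using d_ge by (intro continuous_intros) auto
  then have "isCont S x" unfolding S_def by (intro isCont_sum ballI)
  ultimately show ?thesis
    unfolding p_def using S_pos[of x] by (intro continuous_intros) auto
qed

text \<open>At 0 and at 1 two neighbouring branches tie, so a margin \<kappa> is kept. Then the
  phase of \<open>x\<close> is within \<open>pi * (1 - 2 * \<kappa>) / d\<close> of 0, while the
  phase of \<open>x + i\<close> keeps distance \<open>pi * (1 + 2 * \<kappa>) / d\<close> from both
  0 and \<open>2 * pi\<close>.\<close>

lemma c_gap:
  assumes \<kappa>: "0 < \<kappa>" "\<kappa> \<le> 1 / 4" and x: "\<kappa> \<le> x" "x \<le> 1 - \<kappa>" and i: "1 \<le> i" "i < d"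
  shows "c (x + real i) \<le> cos (pi * (1 + 2 * \<kappa>) / real d)" "cos (pi * (1 - 2 * \<kappa>) / real d) \<le> c x"
proof -
  have d: "real d \<ge> 2" using d_ge by simp
  define \<alpha> where "\<alpha> = pi * (1 + 2 * \<kappa>) / real d"
  define \<theta> where "\<theta> = 2 * pi * (x + real i - 1 / 2) / real d"
  have "pi * (1 + 2 * \<kappa>) \<le> pi * (2 * (x + real i - 1 / 2))"
    using x i by (intro mult_left_mono) auto
  then have "\<alpha> \<le> \<theta>" unfolding \<alpha>_def \<theta>_def using d by (simp add: divide_right_mono mult_ac)
  have "real i + 1 \<le> real d" using i by simp
  then have "pi * (2 * (x + real i - 1 / 2)) \<le> pi * (2 * real d - (1 + 2 * \<kappa>))"
    using x by (intro mult_left_mono) auto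
  then have "\<theta> \<le> pi * (2 * real d - (1 + 2 * \<kappa>)) / real d"
    unfolding \<theta>_def using d by (simp add: divide_right_mono mult_ac)
  also have "\<dots> = 2 * pi - \<alpha>" unfolding \<alpha>_def using d by (simp add: field_simps)
  finally have "\<theta> \<le> 2 * pi - \<alpha>" .
  have "0 \<le> \<alpha>" unfolding \<alpha>_def using \<kappa> by simp
  show "c (x + real i) \<le> cos (pi * (1 + 2 * \<kappa>) / real d)"
  proof (cases "\<theta> \<le> pi")
    case True
    then have "cos \<theta> \<le> cos \<alpha>" using \<open>0 \<le> \<alpha>\<close> \<open>\<alpha> \<le> \<theta>\<close> by (intro cos_monotone_0_pi_le)
    then show ?thesis by (simp add: c_def \<theta>_def \<alpha>_def)
  next
    case False
    then have "cos (2 * pi - \<theta>) \<le> cos \<alpha>"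
      using \<open>0 \<le> \<alpha>\<close> \<open>\<theta> \<le> 2 * pi - \<alpha>\<close> by (intro cos_monotone_0_pi_le) auto
    then show ?thesis by (simp add: c_def \<theta>_def \<alpha>_def cos_diff)
  qed
  define \<psi> where "\<psi> = \<bar>2 * pi * (x - 1 / 2) / real d\<bar>"
  have "\<psi> = pi * (2 * \<bar>x - 1 / 2\<bar>) / real d" by (simp add: \<psi>_def abs_mult)
  also have "\<dots> \<le> pi * (1 - 2 * \<kappa>) / real d"
    using x d by (intro divide_right_mono mult_left_mono) (auto simp: abs_if)
  finally have "\<psi> \<le> pi * (1 - 2 * \<kappa>) / real d" .
  moreover have "pi * (1 - 2 * \<kappa>) / real d \<le> pi"
    using \<kappa> d mult_mono[of "1 - 2 * \<kappa>" 1 1 "real d"] by (simp add: divide_le_eq)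
  ultimately have "cos (pi * (1 - 2 * \<kappa>) / real d) \<le> cos \<psi>"
    by (intro cos_monotone_0_pi_le) (auto simp: \<psi>_def)
  then show "cos (pi * (1 - 2 * \<kappa>) / real d) \<le> c x" unfolding \<psi>_def c_def cos_abs_real .
qed

lemma p_concentrated:
  assumes \<kappa>: "0 < \<kappa>" "\<kappa> \<le> 1 / 4" and x: "\<kappa> \<le> x" "x \<le> 1 - \<kappa>"
  shows "1 - real d * exp (- N * (cos (pi * (1 - 2 * \<kappa>) / real d) - cos (pi * (1 + 2 * \<kappa>) / real d))) \<le> p x"
proof -
  define \<gamma> where "\<gamma> = cos (pi * (1 - 2 * \<kappa>) / real d) - cos (pi * (1 + 2 * \<kappa>) / real d)"
  have le: "u (x + real i) \<le> exp (- N * \<gamma>) * u x" if i: "i \<in> {..<d} - {0}" for i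
  proof -
    have "c (x + real i) \<le> c x - \<gamma>" using c_gap[OF \<kappa> x, of i] i unfolding \<gamma>_def by auto
    then have "N * c (x + real i) \<le> N * (c x - \<gamma>)" using N_pos by (intro mult_left_mono) auto
    then have "N * c (x + real i) \<le> - N * \<gamma> + N * c x" by (simp add: algebra_simps)
    then show ?thesis unfolding u_def by (simp flip: exp_add)
  qed
  have "S x = u x + (\<Sum>i\<in>{..<d} - {0}. u (x + real i))"
    unfolding S_def using d_ge by (subst sum.remove[of _ 0]) auto
  also have "(\<Sum>i\<in>{..<d} - {0}. u (x + real i)) \<le> (\<Sum>i\<in>{..<d} - {0}. exp (- N * \<gamma>) * u x)"
    by (intro sum_mono le)
  also have "\<dots> \<le> (\<Sum>i<d. exp (- N * \<gamma>) * u x)"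
    using u_pos by (intro sum_mono2) (auto intro: less_imp_le)
  finally have Sx: "S x \<le> (1 + real d * exp (- N * \<gamma>)) * u x" by (simp add: algebra_simps)
  define q where "q = real d * exp (- N * \<gamma>)"
  have q: "0 \<le> q" by (simp add: q_def)
  \<comment> \<open>Essentially \<open>1 / (1 + q) \<ge> 1 - q\<close>; for \<open>q > 1\<close> the
    left side is not positive.\<close>
  have "(1 - q) * S x \<le> u x"
  proof (cases "q \<le> 1")
    case True
    then have "(1 - q) * S x \<le> (1 - q) * ((1 + q) * u x)"
      using Sx by (intro mult_left_mono) (auto simp: q_def)
    also have "\<dots> = u x - q\<^sup>2 * u x" by (simp add: algebra_simps power2_eq_square)
    also have "\<dots> \<le> u x" using u_pos[of x] by simp
    finally show ?thesis .
  next
    case False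
    then have "(1 - q) * S x \<le> 0" using S_pos[of x] by (intro mult_nonpos_nonneg) auto
    with u_pos[of x] show ?thesis by linarith
  qed
  then show ?thesis
    unfolding p_def using S_pos[of x] by (simp add: le_divide_eq q_def \<gamma>_def)
qed

lemma obtain_primitive:
  obtains G where "inverse_lift d G p (2 * K) (exp (- 2 * N) / real d)"
proof -
  have "\<exists>G. \<forall>x::real. - \<infinity> < ereal x \<longrightarrow> ereal x < \<infinity> \<longrightarrow> (G has_vector_derivative p x) (at x)"
    by (rule einterval_antiderivative) (auto intro: p_continuous)
  then obtain G0 where "\<And>x. (G0 has_vector_derivative p x) (at x)" by auto
  then have G0: "(G0 has_real_derivative p x) (at x)" for x
    by (simp add: has_real_derivative_iff_has_vector_derivative)
  have "((\<lambda>x. G0 x - G0 0) has_real_derivative p x) (at x)" for x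
    using DERIV_diff[OF G0 DERIV_const] by simp
  then have "inverse_lift d (\<lambda>x. G0 x - G0 0) p (2 * K) (exp (- 2 * N) / real d)"
    using d_ge p_sum p_ge p_distortion N_pos by unfold_locales (auto simp: K_def)
  then show ?thesis by (rule that)
qed

end

lemma exists_inverse_lift:
  assumes d: "d \<ge> 2" and \<delta>: "\<delta> > 0"
  shows "\<exists>G p L m. inverse_lift d G p L m \<and> 1 - G 1 \<le> \<delta>"
proof -
  \<comment> \<open>The two margins lose \<open>2 * \<kappa> \<le> \<delta> / 2\<close>; the bound
    1/4 is what the gap estimate requires.\<close>
  define \<kappa> where "\<kappa> = min (\<delta> / 4) (1 / 4)"
  have \<kappa>: "0 < \<kappa>" "\<kappa> \<le> 1 / 4" "\<kappa> \<le> \<delta> / 4" using \<delta> by (auto simp: \<kappa>_def)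
  define \<gamma> where "\<gamma> = cos (pi * (1 - 2 * \<kappa>) / real d) - cos (pi * (1 + 2 * \<kappa>) / real d)"
  have dr: "real d \<ge> 2" using d by simp
  have "\<gamma> > 0"
  proof -
    have "pi * (1 + 2 * \<kappa>) \<le> pi * real d" using \<kappa> dr by (intro mult_left_mono) auto
    then have "pi * (1 + 2 * \<kappa>) / real d \<le> pi" using dr by (simp add: divide_le_eq)
    moreover have "pi * (1 - 2 * \<kappa>) / real d < pi * (1 + 2 * \<kappa>) / real d"
      using \<kappa> dr by (intro divide_strict_right_mono mult_strict_left_mono) auto
    moreover have "0 \<le> pi * (1 - 2 * \<kappa>) / real d" using \<kappa> by simp
    ultimately show ?thesis unfolding \<gamma>_def using cos_monotone_0_pi by fastforce
  qed
  \<comment> \<open>Chosen so that \<open>d * exp (- N * \<gamma>) \<le> \<delta> / 2\<close>, the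
    other half of the loss; the maximum with 1 ensures \<open>N > 0\<close>.\<close>
  define N where "N = max 1 (ln (2 * real d / \<delta>) / \<gamma>)"
  interpret softmax d N using d by unfold_locales (auto simp: N_def)
  have "ln (2 * real d / \<delta>) / \<gamma> * \<gamma> \<le> N * \<gamma>"
    using \<open>\<gamma> > 0\<close> by (intro mult_right_mono) (auto simp: N_def)
  then have "ln (2 * real d / \<delta>) \<le> N * \<gamma>" using \<open>\<gamma> > 0\<close> by simp
  then have "exp (- N * \<gamma>) \<le> exp (- ln (2 * real d / \<delta>))" by simp
  also have "\<dots> = \<delta> / (2 * real d)" using \<delta> dr by (simp add: exp_minus)
  finally have small: "real d * exp (- N * \<gamma>) \<le> \<delta> / 2" using dr by (simp add: field_simps)
  obtain G where G: "inverse_lift d G p (2 * K) (exp (- 2 * N) / real d)" by (rule obtain_primitive)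
  then interpret inverse_lift d G p "2 * K" "exp (- 2 * N) / real d" .
  have "\<kappa> < 1 - \<kappa>" using \<kappa> by simp
  then obtain z where z: "\<kappa> < z" "z < 1 - \<kappa>" "G (1 - \<kappa>) - G \<kappa> = (1 - \<kappa> - \<kappa>) * p z"
    by (rule G_mvt)
  have "1 - \<delta> / 2 \<le> p z"
    using p_concentrated[OF \<kappa>(1,2), of z] z small unfolding \<gamma>_def by simp
  then have "(1 - 2 * \<kappa>) * (1 - \<delta> / 2) \<le> (1 - 2 * \<kappa>) * p z" using \<kappa> by (intro mult_left_mono) auto
  also have "\<dots> = G (1 - \<kappa>) - G \<kappa>" using z(3) by simp
  also have "\<dots> \<le> G 1"
  proof -
    have "G (1 - \<kappa>) \<le> G 1" "G 0 \<le> G \<kappa>" using \<kappa> by (simp_all only: G_le_iff)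
    then show ?thesis unfolding G_0 by linarith
  qed
  finally have "(1 - 2 * \<kappa>) * (1 - \<delta> / 2) \<le> G 1" .
  moreover have "(1 - 2 * \<kappa>) * (1 - \<delta> / 2) = 1 - 2 * \<kappa> - \<delta> / 2 + \<kappa> * \<delta>" by (simp add: algebra_simps)
  moreover have "0 \<le> \<kappa> * \<delta>" using \<kappa> \<delta> by simp
  ultimately have "1 - G 1 \<le> \<delta>" using \<kappa>(3) by linarith
  with G show ?thesis by blast
qed


section \<open>The infimum\<close>

text \<open>The Teichmueller class used is that of \<open>f\<close> itself.\<close>

lemma (in inverse_lift) exists_marked_system:
  "\<exists>\<tau>. \<tau> \<in> TUS d \<and> represents d f \<tau> \<and> symmetric_measure circle_lebesgue \<and>
    invariant_measure circle_lebesgue f"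
  using f_in_US symmetric_circle_lebesgue[OF symmetry_modulus_modulus] invariant_f
  by (auto simp: TUS_def marked_US_def represents_def intro!: quotientI)

theorem theorem22:
  fixes d :: nat
  assumes "d \<ge> 2"
  shows "Inf {metric_entropy \<mu> f | \<tau> f \<mu>.
           \<tau> \<in> TUS d \<and> represents d f \<tau> \<and> symmetric_measure \<mu> \<and> invariant_measure \<mu> f} = 0"
    (is "Inf ?E = 0")
proof (rule antisym)
  show "Inf ?E \<le> 0"
  proof (rule ereal_le_epsilon2)
    fix e :: real assume e: "0 < e"
    \<comment> \<open>Solves \<open>2 * d * sqrt \<delta> = e\<close>.\<close>
    define \<delta> where "\<delta> = (e / (2 * real d))\<^sup>2"
    have "\<delta> > 0" using e assms by (simp add: \<delta>_def)
    then obtain G p L m where "inverse_lift d G p L m" and G1: "1 - G 1 \<le> \<delta>"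
      using exists_inverse_lift[OF assms] by blast
    then interpret inverse_lift d G p L m by simp
    obtain \<tau> where "\<tau> \<in> TUS d \<and> represents d f \<tau> \<and> symmetric_measure circle_lebesgue \<and>
        invariant_measure circle_lebesgue f"
      using exists_marked_system by blast
    then have "Inf ?E \<le> metric_entropy circle_lebesgue f" by (intro Inf_lower) blast
    also have "\<dots> \<le> ereal (2 * real d * sqrt (1 - G 1))" by (rule metric_entropy_f_le)
    also have "\<dots> \<le> ereal (2 * real d * sqrt \<delta>)" using G1
      by (simp add: mult_left_mono)
    also have "2 * real d * sqrt \<delta> = e" using e assms by (simp add: \<delta>_def)
    finally show "Inf ?E \<le> 0 + ereal e" by simp
  qed
  show "0 \<le> Inf ?E"
  proof (rule Inf_greatest)
    fix x assume "x \<in> ?E"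
    then obtain f \<mu> where x: "x = metric_entropy \<mu> f"
      and "symmetric_measure \<mu>" "invariant_measure \<mu> f" by blast
    then interpret measure_preserving \<mu> f
      by (simp add: measure_preserving_def measure_preserving_axioms_def symmetric_measure_def
          circle_prob_def invariant_measure_def)
    show "0 \<le> x" unfolding x by (rule metric_entropy_nonneg)
  qed
qed

end
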